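(* Assume the setting described in the context. The transvectants $(\alpha^{\mathbf k},\beta^{\boldsymbol\ell})^{(s)}$ with $\mathbf k\in\acute A$, $\boldsymbol\ell\in\grave A$, $0\le s\le\widehat\alpha\mathbf k$, $0\le s\le\widehat\beta\boldsymbol\ell$ (the admissible transvectants) form a vector space basis of the polynomial invariants $\mathcal J\cap\mathbb R[\mathbf x,\mathbf y]$, and a formal vector space basis of $\mathcal J$ (they are linearly independent and every element of $\mathcal J$ is a countable linear combination of them).
   Context: For a real square matrix $A_0$ and a formal power series $f$ put $\mathcal D_{A_0}f(\mathbf x)=f'(\mathbf x)A_0\mathbf x$. Let $(\acute X,\acute Y,\acute Z)$, $(\grave X,\grave Y,\grave Z)$ be $\mathfrak{sl}_2$ triads ($[X,Y]=Z,[Z,X]=2X,[Z,Y]=-2Y$) of real $n\times n$ resp. $m\times m$ matrices, with variables $\mathbf x\in\mathbb R^n$, $\mathbf y\in\mathbb R^m$ (independent). On $\mathbb R[[\mathbf x]]$: $\acute{\mathcal X}=\mathcal D_{\acute Y},\acute{\mathcal Y}=\mathcal D_{\acute X},\acute{\mathcal Z}=\mathcal D_{\acute Z}$; on $\mathbb R[[\mathbf y]]$ analogously $\grave{\mathcal X},\grave{\mathcal Y},\grave{\mathcal Z}$; on $\mathbb R[[\mathbf x,\mathbf y]]$: $\mathcal X=\acute{\mathcal X}+\grave{\mathcal X}$. $\acute{\mathcal J}=\ker\acute{\mathcal X}$, $\grave{\mathcal J}=\ker\grave{\mathcal X}$, $\mathcal J=\ker\mathcal X$. A weight invariant of $\acute{\mathcal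 J}$ is $f\in\acute{\mathcal J}$ with $\acute{\mathcal Z}f=\widehat ff$ (similarly for $\grave{\mathcal J}$). $\alpha=(\alpha_1,\dots,\alpha_p)$ is a Hilbert basis of $\acute{\mathcal J}$: homogeneous weight invariants (weights $\widehat\alpha_i$) such that every element of $\acute{\mathcal J}$ is a countable linear combination of monomials $\alpha^{\mathbf k}$; $\widehat\alpha\mathbf k=\sum\widehat\alpha_ik_i$. Likewise $\beta=(\beta_1,\dots,\beta_q)$ for $\grave{\mathcal J}$. $\acute A\subset\mathbb N^p$ is a standard preferred set: the $\alpha^{\mathbf k}$, $\mathbf k\in\acute A$, are pairwise distinct, linearly independent and span $\acute{\mathcal J}$ by countable linear combinations, and $\acute A$ is closed under componentwise-smaller vectors; likewise $\grave A\subset\mathbb N^q$ for $\beta$. External transvectant: for weight invariants $f\in\acute{\mathcal J}$, $g\in\grave{\mathcal J}$, integer $0\le s\le\min(\widehat f,\widehat g)$: $(f,g)^{(s)}=\sum_{j=0}^s(-1)^j\binom sj\frac{(\widehat f-j)!}{(\widehat f-s)!}\frac{(\widehat g-s+j)!}{(\widehat g-s)!}(\acute{\mathcal Y}^jf)(\grave{\mathcal Y}^{s-j}g)$. The weight of $\alpha^{\mathbf k}$ is $\widehat\alpha\mathbf k$. *)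

theory Defs
  imports "HOL-Analysis.Analysis"
begin

text \<open>Formal power series in the (finitely many) variables of type 'v with real
coefficients, represented by their coefficient functions on exponent vectors.\<close>
type_synonym 'v mfps = "('v \<Rightarrow> nat) \<Rightarrow> real"

definition mdeg :: "('v::finite \<Rightarrow> nat) \<Rightarrow> nat" where
  "mdeg \<mu> = (\<Sum>v\<in>UNIV. \<mu> v)"

definition homogeneous :: "'v::finite mfps \<Rightarrow> bool" where
  "homogeneous f \<longleftrightarrow> (\<exists>d. \<forall>\<mu>. f \<mu> \<noteq> 0 \<longrightarrow> mdeg \<mu> = d)"

definition is_polynomial :: "'v mfps \<Rightarrow> bool" where
  "is_polynomial f \<longleftrightarrow> finite {\<mu>. f \<mu> \<noteq> 0}"

definition pdiff :: "'v \<Rightarrow> 'v mfps \<Rightarrow> 'v mfps" where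
  "pdiff i f = (\<lambda>\<mu>. real (\<mu> i + 1) * f (\<mu>(i := \<mu> i + 1)))"

definition mulvar :: "'v \<Rightarrow> 'v mfps \<Rightarrow> 'v mfps" where
  "mulvar j g = (\<lambda>\<mu>. if 1 \<le> \<mu> j then g (\<mu>(j := \<mu> j - 1)) else 0)"

text \<open>D_A f (x) = f'(x) A x = sum_i sum_j A_ij x_j d f/d x_i, for a matrix given
as a function of indices\<close>
definition Dop :: "('v::finite \<Rightarrow> 'v \<Rightarrow> real) \<Rightarrow> 'v mfps \<Rightarrow> 'v mfps" where
  "Dop A f = (\<lambda>\<mu>. \<Sum>i\<in>UNIV. \<Sum>j\<in>UNIV. A i j * mulvar j (pdiff i f) \<mu>)"

definition Dmat :: "real^'n^'n \<Rightarrow> 'n::finite mfps \<Rightarrow> 'n mfps" where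
  "Dmat A = Dop (\<lambda>i j. A $ i $ j)"

definition Dmat_x :: "real^'n^'n \<Rightarrow> ('n::finite + 'm::finite) mfps \<Rightarrow> ('n + 'm) mfps" where
  "Dmat_x A = Dop (\<lambda>u v. case (u, v) of (Inl i, Inl j) \<Rightarrow> A $ i $ j | _ \<Rightarrow> 0)"

definition Dmat_y :: "real^'m^'m \<Rightarrow> ('n::finite + 'm::finite) mfps \<Rightarrow> ('n + 'm) mfps" where
  "Dmat_y B = Dop (\<lambda>u v. case (u, v) of (Inr i, Inr j) \<Rightarrow> B $ i $ j | _ \<Rightarrow> 0)"

definition sl2_triad :: "real^'n^'n \<Rightarrow> real^'n^'n \<Rightarrow> real^'n^'n \<Rightarrow> bool" where
  "sl2_triad X Y Z \<longleftrightarrow> X ** Y - Y ** X = Z \<and> Z ** X - X ** Z = (2::real) *\<^sub>R X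
     \<and> Z ** Y - Y ** Z = - ((2::real) *\<^sub>R Y)"

definition mone :: "'v mfps" where
  "mone = (\<lambda>\<mu>. if \<mu> = (\<lambda>_. 0) then 1 else 0)"

definition mmul :: "'v mfps \<Rightarrow> 'v mfps \<Rightarrow> 'v mfps" where
  "mmul f g = (\<lambda>\<mu>. \<Sum>\<nu>\<in>{\<nu>. \<forall>v. \<nu> v \<le> \<mu> v}. f \<nu> * g (\<lambda>v. \<mu> v - \<nu> v))"

definition mpow :: "'v mfps \<Rightarrow> nat \<Rightarrow> 'v mfps" where
  "mpow f k = (mmul f ^^ k) mone"

primrec mprodn :: "nat \<Rightarrow> (nat \<Rightarrow> 'v mfps) \<Rightarrow> 'v mfps" where
  "mprodn 0 F = mone"
| "mprodn (Suc p) F = mmul (mprodn p F) (F p)"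

definition mmono :: "nat \<Rightarrow> (nat \<Rightarrow> 'v mfps) \<Rightarrow> (nat \<Rightarrow> nat) \<Rightarrow> 'v mfps" where
  "mmono p \<alpha> k = mprodn p (\<lambda>i. mpow (\<alpha> i) (k i))"

definition wdot :: "nat \<Rightarrow> (nat \<Rightarrow> nat) \<Rightarrow> (nat \<Rightarrow> nat) \<Rightarrow> nat" where
  "wdot p w k = (\<Sum>i<p. w i * k i)"

definition natvecs :: "nat \<Rightarrow> (nat \<Rightarrow> nat) set" where
  "natvecs p = {k. \<forall>i\<ge>p. k i = 0}"

definition down_closed :: "(nat \<Rightarrow> nat) set \<Rightarrow> bool" where
  "down_closed A \<longleftrightarrow> (\<forall>k\<in>A. \<forall>k'. (\<forall>i. k' i \<le> k i) \<longrightarrow> k' \<in> A)"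

definition tens :: "'n mfps \<Rightarrow> 'm mfps \<Rightarrow> ('n + 'm) mfps" where
  "tens f g = (\<lambda>\<mu>. f (\<mu> \<circ> Inl) * g (\<mu> \<circ> Inr))"

definition lin_indep :: "'i set \<Rightarrow> ('i \<Rightarrow> 'v mfps) \<Rightarrow> bool" where
  "lin_indep I F \<longleftrightarrow> (\<forall>S c. finite S \<longrightarrow> S \<subseteq> I \<longrightarrow> (\<forall>\<mu>. (\<Sum>t\<in>S. c t * F t \<mu>) = 0)
       \<longrightarrow> (\<forall>t\<in>S. c t = 0))"

definition fin_lin_comb :: "'i set \<Rightarrow> ('i \<Rightarrow> 'v mfps) \<Rightarrow> 'v mfps \<Rightarrow> bool" where
  "fin_lin_comb I F f \<longleftrightarrow> (\<exists>S c. finite S \<and> S \<subseteq> I \<and> f = (\<lambda>\<mu>. \<Sum>t\<in>S. c t * F t \<mu>))"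

text \<open>countable (formal) linear combination: coefficientwise only finitely many
nonzero contributions (the index sets used are countable)\<close>
definition count_lin_comb :: "'i set \<Rightarrow> ('i \<Rightarrow> 'v mfps) \<Rightarrow> 'v mfps \<Rightarrow> bool" where
  "count_lin_comb I F f \<longleftrightarrow> (\<exists>c. \<forall>\<mu>. finite {t\<in>I. c t * F t \<mu> \<noteq> 0} \<and>
       f \<mu> = (\<Sum>t\<in>{t\<in>I. c t * F t \<mu> \<noteq> 0}. c t * F t \<mu>))"

text \<open>external transvectant (f,g)^(s); Ya, Yg are the operators acute-Y, grave-Y,
wdf, wdg the weights of f and g\<close>
definition transvectant ::
  "('n mfps \<Rightarrow> 'n mfps) \<Rightarrow> ('m mfps \<Rightarrow> 'm mfps) \<Rightarrow> nat \<Rightarrow> 'n mfps \<Rightarrow> nat \<Rightarrow> 'm mfps \<Rightarrow> nat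
     \<Rightarrow> ('n + 'm) mfps" where
  "transvectant Ya Yg wdf f wdg g s = (\<lambda>\<mu>. \<Sum>j\<le>s.
      (-1)^j * real (s choose j) * (fact (wdf - j) / fact (wdf - s))
        * (fact (wdg - s + j) / fact (wdg - s))
        * tens ((Ya ^^ j) f) ((Yg ^^ (s - j)) g) \<mu>)"

end

theory Submission
  imports Defs "HOL-Library.Function_Algebras"
begin

text \<open>
  All operators preserve bidegree, so the claim reduces to a statement about \<open>V \<otimes> W\<close> for the
  finite-dimensional spaces \<open>V\<close>, \<open>W\<close> of forms of fixed degrees. In \<open>V\<close>, \<open>X\<close> is nilpotent and the strings
  \<open>Y\<^sup>j e\<^sub>k\<close> with \<open>j \<le> w\<^sub>k\<close>, \<open>e\<^sub>k\<close> running through a weight basis of the kernel of \<open>X\<close>, form a basis.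
  An element of \<open>V \<otimes> W\<close> is therefore uniquely \<open>\<Sum> Y\<^sup>j e\<^sub>k \<otimes> g\<^sub>k\<^sub>j\<close>, and it is killed by \<open>X\<close> iff
  \<open>X g\<^sub>k\<^sub>j = - (j + 1) (w\<^sub>k - j) g\<^sub>k\<^sub>,\<^sub>j\<^sub>+\<^sub>1\<close>. So it is determined by the \<open>g\<^sub>k\<^sub>0\<close>, which lie in the kernel of the
  power \<open>w\<^sub>k + 1\<close> of \<open>X\<close>; that kernel is spanned by the \<open>Y\<^sup>s f\<^sub>l\<close> with \<open>s \<le> min w\<^sub>k w\<^sub>l\<close>, and these are up to nonzero
  factors the leading coefficients \<open>g\<^sub>k\<^sub>0\<close> of the transvectants.
\<close>

section \<open>Linear vector fields on formal power series\<close>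

text \<open>Pointwise scaling turns coefficient functions into a real vector space, so that
  \<open>linear\<close>, \<open>span\<close> and \<open>independent\<close> apply to power series,
  and also to families of them in \<open>Xpow_relation\<close>.\<close>

instantiation "fun" :: (type, scaleR) scaleR
begin
definition scaleR_fun :: "real \<Rightarrow> ('a \<Rightarrow> 'b) \<Rightarrow> 'a \<Rightarrow> 'b" where
  "scaleR_fun c f = (\<lambda>x. c *\<^sub>R f x)"
instance ..
end

lemma scaleR_fun_apply [simp]: "(c *\<^sub>R f) x = c *\<^sub>R f x"
  by (simp add: scaleR_fun_def)

instance "fun" :: (type, real_vector) real_vector
  by standard (auto simp: fun_eq_iff algebra_simps)

lemma sum_apply: "(\<Sum>i\<in>S. f i) x = (\<Sum>i\<in>S. f i x)"
  by (induction S rule: infinite_finite_induct) auto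

section \<open>Commutators of linear vector fields\<close>

lemma linear_pdiff: "linear (pdiff i)"
  by (rule linearI) (auto simp: pdiff_def fun_eq_iff algebra_simps)

lemma linear_mulvar: "linear (mulvar j)"
  by (rule linearI) (auto simp: mulvar_def fun_eq_iff)

lemma Dop_eq_sum: "Dop A f = (\<Sum>i\<in>UNIV. \<Sum>j\<in>UNIV. A i j *\<^sub>R mulvar j (pdiff i f))"
  by (simp add: Dop_def fun_eq_iff sum_apply)

lemma linear_Dop: "linear (Dop A)"
  by (rule linearI)
     (simp_all add: Dop_eq_sum linear_add[OF linear_pdiff] linear_add[OF linear_mulvar]
        linear_cmul[OF linear_pdiff] linear_cmul[OF linear_mulvar] sum.distrib scaleR_add_right
        scaleR_sum_right mult.commute)

lemma pdiff_pdiff: "pdiff i (pdiff j f) = pdiff j (pdiff i f)"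
  by (cases "i = j") (auto simp: pdiff_def fun_eq_iff fun_upd_twist)

lemma mulvar_mulvar: "mulvar i (mulvar j f) = mulvar j (mulvar i f)"
  by (cases "i = j") (auto simp: mulvar_def fun_eq_iff fun_upd_twist)

lemma pdiff_mulvar: "pdiff i (mulvar j f) = mulvar j (pdiff i f) + (if i = j then f else 0)"
proof (cases "i = j")
  case True
  then show ?thesis
    by (auto simp: pdiff_def mulvar_def fun_eq_iff algebra_simps not_le)
next
  case False
  then show ?thesis
    by (auto simp: pdiff_def mulvar_def fun_eq_iff fun_upd_twist)
qed

text \<open>By Leibniz, the outer derivative either passes the coefficient \<open>x_l\<close> of the
  inner field, giving a second-order term, or hits it. The latter forces \<open>l = i\<close> and
  leaves the field of the matrix product \<open>B A\<close>, in reversed order.\<close>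

lemma Dop_Dop:
  "Dop A (Dop B f) =
     (\<Sum>i\<in>UNIV. \<Sum>j\<in>UNIV. \<Sum>k\<in>UNIV. \<Sum>l\<in>UNIV.
        (A i j * B k l) *\<^sub>R mulvar j (mulvar l (pdiff i (pdiff k f))))
     + Dop (\<lambda>i j. \<Sum>k\<in>UNIV. B i k * A k j) f"
proof -
  have *: "(A i j * B k l) *\<^sub>R mulvar j (pdiff i (mulvar l (pdiff k f))) =
      (A i j * B k l) *\<^sub>R mulvar j (mulvar l (pdiff i (pdiff k f)))
      + (if l = i then (A i j * B k l) *\<^sub>R mulvar j (pdiff k f) else 0)" for i j k l
    by (auto simp: pdiff_mulvar linear_add[OF linear_mulvar] linear_0[OF linear_mulvar] scaleR_add_right)
  have "Dop A (Dop B f) = (\<Sum>i\<in>UNIV. \<Sum>j\<in>UNIV. \<Sum>k\<in>UNIV. \<Sum>l\<in>UNIV.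
        (A i j * B k l) *\<^sub>R mulvar j (pdiff i (mulvar l (pdiff k f))))"
    by (simp add: Dop_eq_sum linear_sum[OF linear_mulvar] linear_sum[OF linear_pdiff]
       linear_cmul[OF linear_pdiff] linear_cmul[OF linear_mulvar] scaleR_sum_right)
  also have "\<dots> = (\<Sum>i\<in>UNIV. \<Sum>j\<in>UNIV. \<Sum>k\<in>UNIV. \<Sum>l\<in>UNIV.
        (A i j * B k l) *\<^sub>R mulvar j (mulvar l (pdiff i (pdiff k f))))
     + (\<Sum>i\<in>UNIV. \<Sum>j\<in>UNIV. \<Sum>k\<in>UNIV. \<Sum>l\<in>UNIV.
        if l = i then (A i j * B k l) *\<^sub>R mulvar j (pdiff k f) else 0)"
    by (simp only: * sum.distrib)
  also have "(\<Sum>i\<in>UNIV. \<Sum>j\<in>UNIV. \<Sum>k\<in>UNIV. \<Sum>l\<in>UNIV.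
        if l = i then (A i j * B k l) *\<^sub>R mulvar j (pdiff k f) else 0)
      = (\<Sum>i\<in>UNIV. \<Sum>j\<in>UNIV. \<Sum>k\<in>UNIV. (B k i * A i j) *\<^sub>R mulvar j (pdiff k f))"
    by (simp add: mult.commute)
  also have "(\<Sum>i\<in>UNIV. \<Sum>j\<in>UNIV. \<Sum>k\<in>UNIV. (B k i * A i j) *\<^sub>R mulvar j (pdiff k f))
      = (\<Sum>j\<in>UNIV. \<Sum>k\<in>UNIV. \<Sum>i\<in>UNIV. (B k i * A i j) *\<^sub>R mulvar j (pdiff k f))"
    by (subst sum.swap) (intro sum.cong refl sum.swap)
  also have "(\<Sum>j\<in>UNIV. \<Sum>k\<in>UNIV. \<Sum>i\<in>UNIV. (B k i * A i j) *\<^sub>R mulvar j (pdiff k f))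
      = (\<Sum>k\<in>UNIV. \<Sum>j\<in>UNIV. \<Sum>i\<in>UNIV. (B k i * A i j) *\<^sub>R mulvar j (pdiff k f))"
    by (rule sum.swap)
  also have "(\<Sum>k\<in>UNIV. \<Sum>j\<in>UNIV. \<Sum>i\<in>UNIV. (B k i * A i j) *\<^sub>R mulvar j (pdiff k f)) = Dop (\<lambda>i j. \<Sum>k\<in>UNIV. B i k * A k j) f"
    by (simp add: Dop_eq_sum scaleR_sum_left)
  finally show ?thesis .
qed

lemma Dop_diff_matrix: "Dop A f - Dop B f = Dop (\<lambda>i j. A i j - B i j) f"
  by (simp add: Dop_eq_sum scaleR_diff_left sum_subtractf)

text \<open>The second-order parts of the two composites agree because derivatives commute with each
  other and so do multiplications. Only the first-order parts survive.\<close>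

lemma Dop_commutator:
  "Dop A (Dop B f) - Dop B (Dop A f)
     = Dop (\<lambda>i j. (\<Sum>k\<in>UNIV. B i k * A k j) - (\<Sum>k\<in>UNIV. A i k * B k j)) f"
proof -
  have "(\<Sum>i\<in>UNIV. \<Sum>j\<in>UNIV. \<Sum>k\<in>UNIV. \<Sum>l\<in>UNIV.
        (A i j * B k l) *\<^sub>R mulvar j (mulvar l (pdiff i (pdiff k f))))
     = (\<Sum>k\<in>UNIV. \<Sum>l\<in>UNIV. \<Sum>i\<in>UNIV. \<Sum>j\<in>UNIV.
        (A i j * B k l) *\<^sub>R mulvar j (mulvar l (pdiff i (pdiff k f))))"
    unfolding sum.cartesian_product
    \<comment> \<open>Exchanging the index pairs \<open>(i, j)\<close> and \<open>(k, l)\<close>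
      interchanges the two fields.\<close>
    by (rule sum.reindex_bij_witness[of _ "\<lambda>(k, l, i, j). (i, j, k, l)" "\<lambda>(i, j, k, l). (k, l, i, j)"]) auto
  also have "\<dots> = (\<Sum>k\<in>UNIV. \<Sum>l\<in>UNIV. \<Sum>i\<in>UNIV. \<Sum>j\<in>UNIV.
        (B k l * A i j) *\<^sub>R mulvar l (mulvar j (pdiff k (pdiff i f))))"
    by (simp add: mulvar_mulvar pdiff_pdiff mult.commute)
  finally show ?thesis
    by (simp add: Dop_Dop Dop_diff_matrix[symmetric])
qed

lemma Dmat_commutator: "Dmat A (Dmat B f) - Dmat B (Dmat A f) = Dmat (B ** A - A ** B) f"
  by (simp add: Dmat_def Dop_commutator matrix_matrix_mult_def)

lemma Dmat_scaleR: "Dmat (c *\<^sub>R A) f = c *\<^sub>R Dmat A f"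
  by (simp add: Dmat_def Dop_eq_sum scaleR_sum_right)

lemma linear_Dmat: "linear (Dmat A)"
  by (simp add: Dmat_def linear_Dop)

section \<open>Products, derivations and weights of monomials\<close>

lemma finite_le_fun: "finite {\<nu>. \<forall>v. \<nu> v \<le> (\<mu> v :: nat)}" for \<mu> :: "'v::finite \<Rightarrow> nat"
proof -
  have "{\<nu>. \<forall>v. \<nu> v \<le> \<mu> v} \<subseteq> PiE UNIV (\<lambda>v. {..\<mu> v})" by auto
  then show ?thesis by (rule finite_subset) (auto intro: finite_PiE)
qed

lemma mmul_commute: "mmul f g = mmul g f" for f g :: "'v::finite mfps"
  unfolding mmul_def
proof
  fix \<mu> :: "'v \<Rightarrow> nat"
  show "(\<Sum>\<nu> | \<forall>v. \<nu> v \<le> \<mu> v. f \<nu> * g (\<lambda>v. \<mu> v - \<nu> v))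
      = (\<Sum>\<nu> | \<forall>v. \<nu> v \<le> \<mu> v. g \<nu> * f (\<lambda>v. \<mu> v - \<nu> v))"
    by (rule sum.reindex_bij_witness[of _ "\<lambda>\<nu> v. \<mu> v - \<nu> v" "\<lambda>\<nu> v. \<mu> v - \<nu> v"]) auto
qed

lemma linear_mmul_left: "linear (\<lambda>f. mmul f g)"
  by (rule linearI) (auto simp: mmul_def fun_eq_iff sum.distrib algebra_simps sum_distrib_left)

lemma linear_mmul_right: "linear (mmul f)" for f :: "'v::finite mfps"
  using linear_mmul_left[of f] unfolding mmul_commute[of _ f] .

lemma mulvar_mmul: "mulvar j (mmul f g) = mmul (mulvar j f) g" for f g :: "'v::finite mfps"
proof
  fix \<mu> :: "'v \<Rightarrow> nat"
  show "mulvar j (mmul f g) \<mu> = mmul (mulvar j f) g \<mu>"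
  proof (cases "1 \<le> \<mu> j")
    case True
    let ?m = "\<mu>(j := \<mu> j - 1)"
    have "(\<Sum>\<nu> | \<forall>v. \<nu> v \<le> ?m v. f \<nu> * g (\<lambda>v. ?m v - \<nu> v))
        = (\<Sum>\<nu> | \<forall>v. \<nu> v \<le> \<mu> v. mulvar j f \<nu> * g (\<lambda>v. \<mu> v - \<nu> v))"
    \<comment> \<open>Shift the \<open>j\<close>-exponent of the first factor by one. The terms with
      \<open>\<nu> j = 0\<close> on the right have no partner, but \<open>mulvar j f\<close>
      vanishes there.\<close>
    proof (rule sum.reindex_bij_witness_not_neutral[of "{}" "{\<nu>. (\<forall>v. \<nu> v \<le> \<mu> v) \<and> \<nu> j = 0}" _
          "\<lambda>\<nu>. \<nu>(j := \<nu> j - 1)" "\<lambda>\<nu>. \<nu>(j := \<nu> j + 1)"], goal_cases)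
      case 2 show ?case by (rule finite_subset[OF _ finite_le_fun[of \<mu>]]) auto
    next
      case (4 \<nu>) then show ?case using True by (auto split: if_splits)
    next
      case (6 \<nu>)
      have le: "\<nu> v \<le> \<mu> v" for v using 6 by (simp only: Diff_iff mem_Collect_eq)
      have "(\<nu>(j := \<nu> j - 1)) v \<le> ?m v" for v using le[of v] by (cases "v = j") simp_all
      then show ?case unfolding Diff_empty mem_Collect_eq by (rule allI)
    next
      case (9 \<nu>)
      have "(\<lambda>v. ?m v - \<nu> v) = (\<lambda>v. \<mu> v - (\<nu>(j := \<nu> j + 1)) v)" using True by auto
      then show ?case by (simp add: mulvar_def)
    qed (auto simp: mulvar_def)
    then show ?thesis using True by (simp add: mulvar_def mmul_def)
  next
    case False
    have "mulvar j f \<nu> = 0" if "\<forall>v. \<nu> v \<le> \<mu> v" for \<nu>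
      using False spec[OF that, of j] by (simp add: mulvar_def)
    then have "mmul (mulvar j f) g \<mu> = 0" by (simp add: mmul_def)
    then show ?thesis using False by (simp add: mulvar_def)
  qed
qed

text \<open>The factor \<open>\<mu> i + 1\<close> splits as
  \<open>\<nu> i + (\<mu> i + 1 - \<nu> i)\<close>: the first part differentiates \<open>f\<close>,
  the second \<open>g\<close>.\<close>

lemma pdiff_mmul: "pdiff i (mmul f g) = mmul (pdiff i f) g + mmul f (pdiff i g)" for f g :: "'v::finite mfps"
proof
  fix \<mu> :: "'v \<Rightarrow> nat"
  let ?m = "\<mu>(i := \<mu> i + 1)"
  let ?S = "{\<nu>. \<forall>v. \<nu> v \<le> ?m v}"
  have "pdiff i (mmul f g) \<mu> = (\<Sum>\<nu>\<in>?S. real (\<mu> i + 1) * (f \<nu> * g (\<lambda>v. ?m v - \<nu> v)))"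
    by (simp only: pdiff_def mmul_def sum_distrib_left)
  also have "\<dots> = (\<Sum>\<nu>\<in>?S. real (\<nu> i) * f \<nu> * g (\<lambda>v. ?m v - \<nu> v))
       + (\<Sum>\<nu>\<in>?S. f \<nu> * (real (\<mu> i + 1 - \<nu> i) * g (\<lambda>v. ?m v - \<nu> v)))"
    unfolding sum.distrib[symmetric]
  proof (rule sum.cong[OF refl])
    fix \<nu> assume "\<nu> \<in> ?S"
    then have "\<nu> i \<le> \<mu> i + 1" by (auto dest: spec[of _ i])
    then have "real (\<mu> i + 1) = real (\<nu> i) + real (\<mu> i + 1 - \<nu> i)" by simp
    then show "real (\<mu> i + 1) * (f \<nu> * g (\<lambda>v. ?m v - \<nu> v)) = real (\<nu> i) * f \<nu> * g (\<lambda>v. ?m v - \<nu> v)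
        + f \<nu> * (real (\<mu> i + 1 - \<nu> i) * g (\<lambda>v. ?m v - \<nu> v))"
      by (simp only: algebra_simps)
  qed
  also have "(\<Sum>\<nu>\<in>?S. real (\<nu> i) * f \<nu> * g (\<lambda>v. ?m v - \<nu> v)) = mmul (pdiff i f) g \<mu>"
    unfolding mmul_def
  proof (rule sum.reindex_bij_witness_not_neutral[symmetric, of "{}" "{\<nu>\<in>?S. \<nu> i = 0}" _
          "\<lambda>\<nu>. \<nu>(i := \<nu> i - 1)" "\<lambda>\<nu>. \<nu>(i := \<nu> i + 1)"], goal_cases)
    case 2 show ?case by (rule finite_subset[OF _ finite_le_fun[of ?m]]) auto
  next
    case (6 \<nu>)
    have le: "\<nu> v \<le> ?m v" for v using 6 by (simp only: Diff_iff mem_Collect_eq)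
    have "(\<nu>(i := \<nu> i - 1)) v \<le> \<mu> v" for v using le[of v] by (cases "v = i") simp_all
    then show ?case unfolding Diff_empty mem_Collect_eq by (rule allI)
  next
    case (9 \<nu>)
    have "(\<lambda>v. ?m v - (\<nu>(i := \<nu> i + 1)) v) = (\<lambda>v. \<mu> v - \<nu> v)" by auto
    then show ?case by (simp add: pdiff_def)
  qed (auto split: if_splits)
  \<comment> \<open>Exponents \<open>\<nu>\<close> below \<open>?m\<close> but not below
    \<open>\<mu>\<close> have \<open>\<nu> i = \<mu> i + 1\<close>, so their factor is zero.\<close>
  also have "(\<Sum>\<nu>\<in>?S. f \<nu> * (real (\<mu> i + 1 - \<nu> i) * g (\<lambda>v. ?m v - \<nu> v))) = mmul f (pdiff i g) \<mu>"
    unfolding mmul_def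
  proof (rule sum.mono_neutral_cong_right, goal_cases)
    case 1 show ?case by (rule finite_le_fun)
  next
    case 2 then show ?case by (auto simp: le_SucI)
  next
    case 3
    show ?case
    proof
      fix \<nu> assume "\<nu> \<in> ?S - {\<nu>. \<forall>v. \<nu> v \<le> \<mu> v}"
      then obtain v where le: "\<nu> v \<le> ?m v" and "\<not> \<nu> v \<le> \<mu> v" by blast
      then have "v = i" by (cases "v = i") auto
      with le \<open>\<not> \<nu> v \<le> \<mu> v\<close> have "\<nu> i = \<mu> i + 1" by simp
      then show "f \<nu> * (real (\<mu> i + 1 - \<nu> i) * g (\<lambda>v. ?m v - \<nu> v)) = 0" by simp
    qed
  next
    case (4 \<nu>)
    then have "(\<lambda>v. ?m v - \<nu> v) = (\<lambda>v. \<mu> v - \<nu> v)(i := (\<mu> i - \<nu> i) + 1)"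
      by (auto simp: Suc_diff_le)
    with 4 show ?case by (simp add: pdiff_def Suc_diff_le)
  qed
  finally show "pdiff i (mmul f g) \<mu> = (mmul (pdiff i f) g + mmul f (pdiff i g)) \<mu>"
    by simp
qed

lemma Dop_mmul: "Dop A (mmul f g) = mmul (Dop A f) g + mmul f (Dop A g)"
proof -
  have r: "mulvar j (mmul f g) = mmul f (mulvar j g)" for j and f g :: "'a mfps"
    by (metis mulvar_mmul mmul_commute)
  have "mulvar j (pdiff i (mmul f g)) = mmul (mulvar j (pdiff i f)) g + mmul f (mulvar j (pdiff i g))" for i j
    by (simp add: pdiff_mmul linear_add[OF linear_mulvar] mulvar_mmul[of j "pdiff i f"] r[of j f])
  then show ?thesis
    by (simp add: Dop_eq_sum linear_sum[OF linear_mmul_left] linear_sum[OF linear_mmul_right]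
       linear_cmul[OF linear_mmul_left] linear_cmul[OF linear_mmul_right] scaleR_add_right sum.distrib)
qed

lemma Dop_mone: "Dop A mone = 0"
proof -
  have "pdiff i mone = 0" for i :: 'a
    by (auto simp: pdiff_def mone_def fun_eq_iff)
  then show ?thesis by (simp add: Dop_eq_sum linear_0[OF linear_mulvar])
qed

lemma Dop_mmul_eigen:
  assumes "Dop A f = a *\<^sub>R f" "Dop A g = b *\<^sub>R g"
  shows "Dop A (mmul f g) = (a + b) *\<^sub>R mmul f g"
  by (simp add: Dop_mmul assms linear_cmul[OF linear_mmul_left] linear_cmul[OF linear_mmul_right]
      scaleR_add_left)

lemma Dop_mpow_eigen:
  assumes "Dop A f = a *\<^sub>R f"
  shows "Dop A (mpow f k) = (a * real k) *\<^sub>R mpow f k"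
proof (induction k)
  case 0 show ?case by (simp add: mpow_def Dop_mone)
next
  case (Suc k)
  have "mpow f (Suc k) = mmul f (mpow f k)" by (simp add: mpow_def)
  with Dop_mmul_eigen[OF assms Suc.IH] show ?case by (simp add: algebra_simps)
qed

text \<open>Eigenvalues of a derivation add along products. Eigenvalue 0 on the generators will put
  the monomials into the kernel of \<open>X\<close>; their \<open>Z\<close>-weights give
  \<open>wdot\<close>.\<close>

lemma Dop_mmono_eigen:
  assumes "\<forall>i<p. Dop A (\<alpha> i) = lam i *\<^sub>R \<alpha> i"
  shows "Dop A (mmono p \<alpha> k) = (\<Sum>i<p. lam i * real (k i)) *\<^sub>R mmono p \<alpha> k"
  using assms
proof (induction p)
  case 0 show ?case by (simp add: mmono_def Dop_mone)
next
  case (Suc p)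
  have "Dop A (mmono p \<alpha> k) = (\<Sum>i<p. lam i * real (k i)) *\<^sub>R mmono p \<alpha> k"
    by (rule Suc.IH) (use Suc.prems in auto)
  moreover have "Dop A (mpow (\<alpha> p) (k p)) = (lam p * real (k p)) *\<^sub>R mpow (\<alpha> p) (k p)"
    by (rule Dop_mpow_eigen) (use Suc.prems in auto)
  ultimately have "Dop A (mmul (mmono p \<alpha> k) (mpow (\<alpha> p) (k p))) = ((\<Sum>i<p. lam i * real (k i))
      + lam p * real (k p)) *\<^sub>R mmul (mmono p \<alpha> k) (mpow (\<alpha> p) (k p))"
    by (rule Dop_mmul_eigen)
  then show ?case by (simp add: mmono_def)
qed

section \<open>Total degree\<close>

lemma mdeg_0 [simp]: "mdeg (\<lambda>_. 0) = 0"
  by (simp add: mdeg_def)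

lemma homogeneous_mmul:
  assumes "homogeneous f" "homogeneous g" shows "homogeneous (mmul f g)"
proof -
  from assms obtain a b where ab: "\<And>\<mu>. f \<mu> \<noteq> 0 \<Longrightarrow> mdeg \<mu> = a" "\<And>\<mu>. g \<mu> \<noteq> 0 \<Longrightarrow> mdeg \<mu> = b"
    unfolding homogeneous_def by metis
  have "mdeg \<mu> = a + b" if nz: "mmul f g \<mu> \<noteq> 0" for \<mu>
  proof -
    from nz obtain \<nu> where \<nu>: "\<forall>v. \<nu> v \<le> \<mu> v" "f \<nu> * g (\<lambda>v. \<mu> v - \<nu> v) \<noteq> 0"
      unfolding mmul_def by (metis (mono_tags, lifting) sum.neutral mem_Collect_eq)
    then have "mdeg \<nu> = a" "mdeg (\<lambda>v. \<mu> v - \<nu> v) = b" using ab by auto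
    moreover have "mdeg \<mu> = mdeg \<nu> + mdeg (\<lambda>v. \<mu> v - \<nu> v)"
      using \<nu>(1) by (simp add: mdeg_def sum.distrib[symmetric])
    ultimately show ?thesis by simp
  qed
  then show ?thesis unfolding homogeneous_def by blast
qed

lemma homogeneous_mone: "homogeneous mone"
  by (auto simp: homogeneous_def mone_def)

lemma homogeneous_mmono:
  assumes "\<forall>i<p. homogeneous (\<alpha> i)" shows "homogeneous (mmono p \<alpha> k)"
proof -
  have pow: "homogeneous (mpow f n)" if "homogeneous f" for f :: "'a mfps" and n
    by (induction n) (simp_all add: mpow_def homogeneous_mone homogeneous_mmul that)
  from assms show ?thesis
    unfolding mmono_def
    by (induction p) (simp_all add: homogeneous_mone homogeneous_mmul pow)
qed

lemma finite_mdeg: "finite {\<mu> :: 'v::finite \<Rightarrow> nat. mdeg \<mu> = d}"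
proof -
  have "\<mu> v \<le> mdeg \<mu>" for \<mu> :: "'v \<Rightarrow> nat" and v
    unfolding mdeg_def by (rule member_le_sum) auto
  then have "{\<mu> :: 'v \<Rightarrow> nat. mdeg \<mu> = d} \<subseteq> {\<mu>. \<forall>v. \<mu> v \<le> (\<lambda>_. d) v}" by auto
  then show ?thesis by (rule finite_subset) (rule finite_le_fun)
qed

text \<open>Each \<open>x_j d/dx_i\<close> preserves total degree, so a coefficient of the image
  only reads coefficients of the same degree.\<close>

lemma Dop_cong_degree:
  assumes "\<And>\<nu>. mdeg \<nu> = mdeg \<mu> \<Longrightarrow> f \<nu> = g \<nu>"
  shows "Dop A f \<mu> = Dop A g \<mu>"
proof -
  \<comment> \<open>The additive form avoids truncated subtraction.\<close>
  have deg: "mdeg (\<nu>(j := n)) + \<nu> j = mdeg \<nu> + n" for \<nu> :: "'a \<Rightarrow> nat" and j n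
    by (simp add: mdeg_def sum.remove[of UNIV j])
  have "mulvar j (pdiff i f) \<mu> = mulvar j (pdiff i g) \<mu>" for i j
  proof (cases "1 \<le> \<mu> j")
    case True
    let ?m = "\<mu>(j := \<mu> j - 1)"
    have "mdeg (?m(i := ?m i + 1)) = mdeg \<mu>"
      using deg[of ?m i "?m i + 1"] deg[of \<mu> j "\<mu> j - 1"] True by linarith
    then show ?thesis using assms by (simp add: mulvar_def pdiff_def)
  qed (simp add: mulvar_def)
  then show ?thesis by (simp add: Dop_def)
qed

lemma Dop_zero_apply:
  assumes "\<And>\<nu>. mdeg \<nu> = mdeg \<mu> \<Longrightarrow> f \<nu> = 0"
  shows "Dop A f \<mu> = 0"
  using Dop_cong_degree[of \<mu> f 0 A] assms linear_0[OF linear_Dop, of A] by simp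

section \<open>Separating the two groups of variables\<close>

lemma sum_UNIV_Plus:
  "(\<Sum>u\<in>(UNIV :: ('n::finite + 'm::finite) set). h u) = (\<Sum>i\<in>UNIV. h (Inl i)) + (\<Sum>i\<in>UNIV. h (Inr i))"
  for h :: "_ \<Rightarrow> real"
  by (simp add: UNIV_Plus_UNIV[symmetric] sum.Plus del: UNIV_Plus_UNIV)

lemma case_sum_upd:
  "(case_sum \<nu> \<rho>)(Inl i := n) = case_sum (\<nu>(i := n)) \<rho>"
  "(case_sum \<nu> \<rho>)(Inr i' := n) = case_sum \<nu> (\<rho>(i' := n))"
  by (auto simp: fun_eq_iff split: sum.splits)

text \<open>A series in both groups is read as a function of two exponent vectors; an operator of
  one group then acts with the other vector frozen.\<close>

lemma mulvar_pdiff_case_sum: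
  "mulvar (Inl j) (pdiff (Inl i) f) (case_sum \<nu> \<rho>) = mulvar j (pdiff i (\<lambda>\<nu>. f (case_sum \<nu> \<rho>))) \<nu>"
  "mulvar (Inr j') (pdiff (Inr i') f) (case_sum \<nu> \<rho>) = mulvar j' (pdiff i' (\<lambda>\<rho>. f (case_sum \<nu> \<rho>))) \<rho>"
  unfolding mulvar_def pdiff_def case_sum_upd by simp_all

lemma Dmat_x_case_sum: "Dmat_x A f (case_sum \<nu> \<rho>) = Dmat A (\<lambda>\<nu>. f (case_sum \<nu> \<rho>)) \<nu>"
  by (simp add: Dmat_x_def Dmat_def Dop_def sum_UNIV_Plus mulvar_pdiff_case_sum)

lemma Dmat_y_case_sum: "Dmat_y A f (case_sum \<nu> \<rho>) = Dmat A (\<lambda>\<rho>. f (case_sum \<nu> \<rho>)) \<rho>"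
  by (simp add: Dmat_y_def Dmat_def Dop_def sum_UNIV_Plus mulvar_pdiff_case_sum)

section \<open>Modules over sl2 generated by highest weight vectors\<close>

text \<open>Here \<open>X\<close>, \<open>Y\<close>, \<open>Z\<close> are the operators, not the
  matrices: \<open>X\<close> raises \<open>Z\<close>-weights by 2, \<open>Y\<close> lowers them by
  2.\<close>

locale sl2_ops =
  fixes X Y Z :: "'a::real_vector \<Rightarrow> 'a"
  assumes linX: "linear X" and linY: "linear Y" and linZ: "linear Z"
    and XY: "X (Y v) = Y (X v) + Z v"
    and ZX: "Z (X v) = X (Z v) + 2 *\<^sub>R X v"
    and ZY: "Z (Y v) = Y (Z v) - 2 *\<^sub>R Y v"
begin

lemma linear_pow: "linear T \<Longrightarrow> linear (T ^^ n)" for T :: "'a \<Rightarrow> 'a"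
  by (induction n) (auto simp: o_def intro: linear_compose[unfolded o_def] linear_ident simp: id_def)

lemmas Xs = linear_add[OF linX] linear_cmul[OF linX] linear_sum[OF linX] linear_0[OF linX] linear_diff[OF linX]
lemmas Ys = linear_add[OF linY] linear_cmul[OF linY] linear_sum[OF linY] linear_0[OF linY] linear_diff[OF linY]
lemmas Zs = linear_add[OF linZ] linear_cmul[OF linZ] linear_sum[OF linZ] linear_0[OF linZ] linear_diff[OF linZ]
lemmas Xns = linear_add[OF linear_pow[OF linX]] linear_cmul[OF linear_pow[OF linX]]
  linear_sum[OF linear_pow[OF linX]] linear_0[OF linear_pow[OF linX]] linear_diff[OF linear_pow[OF linX]]

lemma Z_Xpow: "Z ((X ^^ n) v) = (X ^^ n) (Z v) + (2 * real n) *\<^sub>R (X ^^ n) v"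
  by (induction n) (simp_all add: ZX Xs algebra_simps)

lemma Z_Ypow:
  assumes "Z v = c *\<^sub>R v" shows "Z ((Y ^^ n) v) = (c - 2 * real n) *\<^sub>R (Y ^^ n) v"
proof (induction n)
  case (Suc n)
  have "Z ((Y ^^ Suc n) v) = Y (Z ((Y ^^ n) v)) - 2 *\<^sub>R (Y ^^ Suc n) v" by (simp add: ZY)
  also have "\<dots> = (c - 2 * real n) *\<^sub>R (Y ^^ Suc n) v - 2 *\<^sub>R (Y ^^ Suc n) v"
    unfolding Suc.IH Ys by simp
  also have "\<dots> = (c - 2 * real (Suc n)) *\<^sub>R (Y ^^ Suc n) v"
    unfolding scaleR_diff_left[symmetric] by simp
  finally show ?case .
qed (simp add: assms)

text \<open>Each of the \<open>m + 1\<close> copies of \<open>X\<close> passing \<open>Y\<close>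
  leaves a \<open>Z\<close>. Moving that \<open>Z\<close> to the front past \<open>t\<close> copies
  of \<open>X\<close> costs \<open>-2 t\<close>, and over \<open>t \<le> m\<close> these add up to
  \<open>- m (m + 1)\<close>.\<close>

lemma Xpow_Y:
  "(X ^^ Suc m) (Y u) = Y ((X ^^ Suc m) u) + real (Suc m) *\<^sub>R (Z ((X ^^ m) u) - real m *\<^sub>R (X ^^ m) u)"
proof (induction m arbitrary: u)
  case 0 show ?case by (simp add: XY)
next
  case (Suc m)
  have "(X ^^ Suc (Suc m)) (Y u) = X ((X ^^ Suc m) (Y u))" by simp
  also have "\<dots> = Y (X ((X ^^ Suc m) u)) + Z ((X ^^ Suc m) u)
      + real (Suc m) *\<^sub>R (X (Z ((X ^^ m) u)) - real m *\<^sub>R (X ^^ Suc m) u)"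
    unfolding Suc.IH by (simp add: Xs XY)
  also have "X (Z ((X ^^ m) u)) = Z ((X ^^ Suc m) u) - 2 *\<^sub>R (X ^^ Suc m) u"
    by (simp add: ZX)
  finally have eq: "(X ^^ Suc (Suc m)) (Y u) = Y ((X ^^ Suc (Suc m)) u) + (Z ((X ^^ Suc m) u) + real (Suc m) *\<^sub>R
      (Z ((X ^^ Suc m) u) - 2 *\<^sub>R (X ^^ Suc m) u - real m *\<^sub>R (X ^^ Suc m) u))" by simp
  have "b + r *\<^sub>R (b - 2 *\<^sub>R c - (r - 1) *\<^sub>R c) = (r + 1) *\<^sub>R (b - r *\<^sub>R c)" for b c :: 'a and r
  proof -
    have "b - 2 *\<^sub>R c - (r - 1) *\<^sub>R c = b - (2 + (r - 1)) *\<^sub>R c" unfolding scaleR_add_left by simp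
    also have "2 + (r - 1) = r + 1" by simp
    finally show ?thesis by (simp only:) (simp add: scaleR_diff_right scaleR_add_left[of 1 r b] mult.commute add.commute)
  qed
  from this[of _ "real (Suc m)"] show ?case unfolding eq by (simp add: add.commute)
qed

text \<open>The factor is the sum of the weights \<open>w, w - 2, ..., w - 2 n\<close> met on the
  way down. It vanishes at \<open>n = w\<close>, the end of the string.\<close>

lemma X_Ypow_Suc:
  assumes "X e = 0" "Z e = real w *\<^sub>R e"
  shows "X ((Y ^^ Suc n) e) = (real (Suc n) * (real w - real n)) *\<^sub>R (Y ^^ n) e"
proof (induction n)
  case 0 show ?case by (simp add: assms XY Ys)
next
  case (Suc n)
  have "X ((Y ^^ Suc (Suc n)) e) = Y (X ((Y ^^ Suc n) e)) + Z ((Y ^^ Suc n) e)"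
    by (simp add: XY)
  also have "\<dots> = (real (Suc n) * (real w - real n) + (real w - 2 * real (Suc n))) *\<^sub>R (Y ^^ Suc n) e"
    unfolding Suc.IH Z_Ypow[OF assms(2)] Ys scaleR_add_left by simp
  also have "real (Suc n) * (real w - real n) + (real w - 2 * real (Suc n))
      = real (Suc (Suc n)) * (real w - real (Suc n))"
    by (simp add: algebra_simps)
  finally show ?case .
qed

lemma Xpow_Ypow_less:
  assumes "X e = 0" "Z e = real w *\<^sub>R e" "n < m"
  shows "(X ^^ m) ((Y ^^ n) e) = 0"
  using assms(3)
proof (induction m arbitrary: n)
  case (Suc m)
  show ?case
  proof (cases n)
    case 0
    then show ?thesis by (simp only: funpow_Suc_right o_apply) (simp add: assms(1) Xns)
  next
    case (Suc k)
    then show ?thesis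
      using Suc.IH[of k] Suc.prems
      by (simp only: funpow_Suc_right[of m] o_apply X_Ypow_Suc[OF assms(1,2)] Xns) simp
  qed
qed simp

text \<open>The scalar with which \<open>X ^^ n\<close> brings \<open>(Y ^^ n) e\<close> back to
  \<open>e\<close>; it is \<open>n! w! / (w - n)!\<close> for \<open>n \<le> w\<close> and 0
  beyond.\<close>

definition hwc :: "nat \<Rightarrow> nat \<Rightarrow> real" where
  "hwc w n = (\<Prod>t<n. real (Suc t) * (real w - real t))"

lemma hwc_nz: "n \<le> w \<Longrightarrow> hwc w n \<noteq> 0"
  by (auto simp: hwc_def)

lemma Xpow_Ypow_same:
  assumes "X e = 0" "Z e = real w *\<^sub>R e"
  shows "(X ^^ n) ((Y ^^ n) e) = hwc w n *\<^sub>R e"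
proof (induction n)
  case (Suc n)
  have "(X ^^ Suc n) ((Y ^^ Suc n) e) = (X ^^ n) (X ((Y ^^ Suc n) e))"
    by (simp add: funpow_Suc_right del: funpow.simps)
  also have "\<dots> = (real (Suc n) * (real w - real n)) *\<^sub>R (X ^^ n) ((Y ^^ n) e)"
    unfolding X_Ypow_Suc[OF assms] Xns ..
  finally show ?case by (simp add: Suc.IH hwc_def)
qed (simp add: hwc_def)

end

section \<open>Linear relations in finite dimension\<close>

lemma span_image_explicit:
  assumes "finite S" "x \<in> span (g ` S)"
  shows "\<exists>a. x = (\<Sum>i\<in>S. a i *\<^sub>R g i)"
proof -
  let ?W = "{x. \<exists>a. x = (\<Sum>i\<in>S. a i *\<^sub>R g i)}"
  have "subspace ?W"
  proof (rule subspaceI)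
    show "0 \<in> ?W" by (auto intro!: exI[of _ "\<lambda>_. 0"])
  next
    fix x y assume "x \<in> ?W" "y \<in> ?W"
    then obtain a b where "x = (\<Sum>i\<in>S. a i *\<^sub>R g i)" "y = (\<Sum>i\<in>S. b i *\<^sub>R g i)" by blast
    then have "x + y = (\<Sum>i\<in>S. (a i + b i) *\<^sub>R g i)" by (simp add: sum.distrib scaleR_add_left)
    then show "x + y \<in> ?W" by (intro CollectI exI)
  next
    fix r x assume "x \<in> ?W"
    then obtain a where "x = (\<Sum>i\<in>S. a i *\<^sub>R g i)" by blast
    then have "r *\<^sub>R x = (\<Sum>i\<in>S. (r * a i) *\<^sub>R g i)" by (simp add: scaleR_sum_right)
    then show "r *\<^sub>R x \<in> ?W" by (intro CollectI exI)
  qed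
  moreover have "g ` S \<subseteq> ?W"
  proof clarify
    fix i assume "i \<in> S"
    with assms(1) have "(\<Sum>j\<in>S. (if i = j then 1 else 0) *\<^sub>R g j) = (\<Sum>j\<in>S. if i = j then g j else 0)"
      by (intro sum.cong) auto
    also have "\<dots> = g i" using assms(1) \<open>i \<in> S\<close> by simp
    finally show "\<exists>a. g i = (\<Sum>j\<in>S. a j *\<^sub>R g j)" by metis
  qed
  ultimately show ?thesis using assms(2) span_minimal by blast
qed

text \<open>If no term depended on its predecessors, the first \<open>card E + 1\<close> terms would
  be independent inside the span of \<open>E\<close>.\<close>

lemma finite_dim_sequence_relation:
  fixes g :: "nat \<Rightarrow> 'b::real_vector"
  assumes "finite E" "\<And>i. g i \<in> span E"
  shows "\<exists>K a. g K = (\<Sum>i<K. a i *\<^sub>R g i)"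
proof (rule ccontr)
  assume no: "\<not> ?thesis"
  then have nin: "g K \<notin> span (g ` {..<K})" for K
    using span_image_explicit[of "{..<K}" "g K" g] by auto
  have ind: "independent (g ` {..<n}) \<and> card (g ` {..<n}) = n" for n
  proof (induction n)
    case (Suc n)
    have "g n \<notin> g ` {..<n}" using nin[of n] span_base[of "g n" "g ` {..<n}"] by blast
    then have "card (insert (g n) (g ` {..<n})) = Suc n" using Suc by (subst card_insert_disjoint) auto
    moreover have "independent (insert (g n) (g ` {..<n}))"
      using Suc nin[of n] by (intro independent_insertI) auto
    ultimately show ?case by (simp add: lessThan_Suc)
  qed (simp add: independent_empty)
  have "independent (g ` {..<Suc (card E)})" by (rule ind[THEN conjunct1])
  moreover have "g ` {..<Suc (card E)} \<subseteq> span E" by (rule image_subsetI) (rule assms(2))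
  ultimately have "card (g ` {..<Suc (card E)}) \<le> card E"
    by (rule independent_span_bound[OF assms(1), THEN conjunct2])
  then show False by (simp only: ind[THEN conjunct2])
qed

locale sl2_module = sl2_ops X Y Z for X Y Z :: "'a::real_vector \<Rightarrow> 'a" +
  fixes V :: "'a set" and B :: "'a set"
  assumes subV: "subspace V" and finB: "finite B" and VB: "V \<subseteq> span B"
    and XV: "v \<in> V \<Longrightarrow> X v \<in> V" and YV: "v \<in> V \<Longrightarrow> Y v \<in> V" and ZV: "v \<in> V \<Longrightarrow> Z v \<in> V"
begin

lemma XnV: "v \<in> V \<Longrightarrow> (X ^^ n) v \<in> V"
  by (induction n) (auto intro: XV)

lemma YnV: "v \<in> V \<Longrightarrow> (Y ^^ n) v \<in> V"
  by (induction n) (auto intro: YV)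

text \<open>The restrictions of the powers of \<open>X\<close> to \<open>V\<close> lie in a
  finite-dimensional space of maps, so one of them depends on the lower ones.\<close>

lemma Xpow_relation: "\<exists>K a. \<forall>v\<in>V. (X ^^ K) v = (\<Sum>i<K. a i *\<^sub>R (X ^^ i) v)"
proof -
  obtain C where C: "C \<subseteq> V" "independent C" "V \<subseteq> span C"
    using maximal_independent_subset by blast
  have finC: "finite C"
    using independent_span_bound[OF finB C(2)] C(1) VB by auto
  \<comment> \<open>\<open>E\<close> consists of the matrix units sending \<open>c\<close> to
    \<open>b\<close> and all else to 0; \<open>g n\<close> is \<open>X ^^ n\<close> restricted to
    the basis \<open>C\<close>, with 0 outside.\<close>
  define E where "E = (\<lambda>(c, b). (\<lambda>x. if x = c then b else 0)) ` (C \<times> B)"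
  define g where "g n = (\<lambda>x. if x \<in> C then (X ^^ n) x else 0)" for n
  have "g n \<in> span E" for n
  proof -
    have "g n = (\<Sum>c\<in>C. (\<lambda>x. if x = c then (X ^^ n) c else 0))"
      using finC by (auto simp: g_def fun_eq_iff sum_apply)
    also have "\<dots> \<in> span E"
    proof (rule span_sum)
      fix c assume c: "c \<in> C"
      then have "(X ^^ n) c \<in> span B" using C(1) XnV VB by blast
      then obtain a where "(X ^^ n) c = (\<Sum>b\<in>B. a b *\<^sub>R b)"
        using span_image_explicit[OF finB, of "(X ^^ n) c" id] by auto
      then have "(\<lambda>x. if x = c then (X ^^ n) c else 0) = (\<Sum>b\<in>B. a b *\<^sub>R (\<lambda>x. if x = c then b else 0))"
        by (auto simp: fun_eq_iff sum_apply)
      also have "\<dots> \<in> span E"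
        using c by (intro span_sum span_scale span_base) (auto simp: E_def)
      finally show "(\<lambda>x. if x = c then (X ^^ n) c else 0) \<in> span E" .
    qed
    finally show ?thesis .
  qed
  moreover have "finite E" unfolding E_def using finC finB by simp
  ultimately obtain K a where K: "g K = (\<Sum>i<K. a i *\<^sub>R g i)"
    using finite_dim_sequence_relation by blast
  let ?d = "\<lambda>v. (X ^^ K) v - (\<Sum>i<K. a i *\<^sub>R (X ^^ i) v)"
  have lin: "linear ?d"
    by (rule linearI) (simp_all add: Xns sum.distrib scaleR_add_right algebra_simps scaleR_sum_right)
  have "?d c = 0" if "c \<in> C" for c
    using fun_cong[OF K, of c] that by (simp add: g_def sum_apply)
  then have "?d v = 0" if "v \<in> V" for v
    using linear_eq_0_on_span[OF lin, of C v] C(3) that by auto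
  then show ?thesis by (metis eq_iff_diff_eq_0)
qed

text \<open>Bracketing a monic relation of least degree with \<open>Z\<close> multiplies the coefficient of \<open>X\<^sup>i\<close> by \<open>2 i\<close>,
  so minimality leaves only the leading term.\<close>
lemma X_nilpotent: "\<exists>K. \<forall>v\<in>V. (X ^^ K) v = 0"
proof -
  define P where "P K \<longleftrightarrow> (\<exists>a. \<forall>v\<in>V. (X ^^ K) v = (\<Sum>i<K. a i *\<^sub>R (X ^^ i) v))" for K
  define K where "K = (LEAST K. P K)"
  have "\<exists>K. P K" using Xpow_relation by (simp add: P_def)
  then have "P K" unfolding K_def by (rule LeastI_ex)
  then obtain a where a: "\<And>v. v \<in> V \<Longrightarrow> (X ^^ K) v = (\<Sum>i<K. a i *\<^sub>R (X ^^ i) v)"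
    unfolding P_def by blast
  \<comment> \<open>Subtracting the bracketed relation from \<open>2 K\<close> times the original
    one cancels the leading term and multiplies the others by \<open>2 (K - i)\<close>, which is
    nonzero.\<close>
  have rel: "(\<Sum>i<K. (a i * (real K - real i)) *\<^sub>R (X ^^ i) v) = 0" if v: "v \<in> V" for v
  proof -
    have "(2 * real K) *\<^sub>R (X ^^ K) v = Z ((X ^^ K) v) - (X ^^ K) (Z v)"
      by (simp add: Z_Xpow)
    also have "\<dots> = (\<Sum>i<K. a i *\<^sub>R (Z ((X ^^ i) v) - (X ^^ i) (Z v)))"
      by (simp add: a[OF v] a[OF ZV[OF v]] Zs sum_subtractf scaleR_diff_right)
    also have "\<dots> = (\<Sum>i<K. (2 * real i * a i) *\<^sub>R (X ^^ i) v)"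
      by (simp add: Z_Xpow algebra_simps)
    finally have "2 *\<^sub>R (\<Sum>i<K. (a i * (real K - real i)) *\<^sub>R (X ^^ i) v) = 0"
      by (simp add: a[OF v] scaleR_sum_right algebra_simps sum_subtractf scaleR_diff_left)
    then show ?thesis by simp
  qed
  have "a i = 0" if "i < K" for i
  proof (rule ccontr)
    assume "a i \<noteq> 0"
    \<comment> \<open>Solving \<open>rel\<close> for its highest surviving power \<open>M\<close>
      gives a relation of degree \<open>M < K\<close>, against minimality.\<close>
    define M where "M = Max {i. i < K \<and> a i \<noteq> 0}"
    have "M \<in> {i. i < K \<and> a i \<noteq> 0}"
      unfolding M_def using that \<open>a i \<noteq> 0\<close> by (intro Max_in) auto
    then have M: "M < K" "a M \<noteq> 0" by auto
    have aM: "a j = 0" if "M < j" "j < K" for j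
    proof (rule ccontr)
      assume "a j \<noteq> 0"
      then have "j \<le> M" unfolding M_def using that by (intro Max_ge) auto
      then show False using that by simp
    qed
    let ?b = "\<lambda>i. a i * (real K - real i)"
    have bM: "?b M \<noteq> 0" using M by simp
    have "(X ^^ M) v = (\<Sum>i<M. (- ?b i / ?b M) *\<^sub>R (X ^^ i) v)" if "v \<in> V" for v
    proof -
      have "0 = (\<Sum>i<K. ?b i *\<^sub>R (X ^^ i) v)" using rel[OF that] by simp
      also have "\<dots> = (\<Sum>i<Suc M. ?b i *\<^sub>R (X ^^ i) v)"
        using M aM by (intro sum.mono_neutral_right) auto
      finally have "?b M *\<^sub>R (X ^^ M) v = - (\<Sum>i<M. ?b i *\<^sub>R (X ^^ i) v)"
        by (simp add: eq_neg_iff_add_eq_0 add.commute)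
      then have "(1 / ?b M) *\<^sub>R (?b M *\<^sub>R (X ^^ M) v) = (1 / ?b M) *\<^sub>R - (\<Sum>i<M. ?b i *\<^sub>R (X ^^ i) v)"
        by simp
      then show ?thesis using bM by (simp add: scaleR_sum_right sum_negf)
    qed
    then have "P M" unfolding P_def by (intro exI[of _ "\<lambda>i. - ?b i / ?b M"]) blast
    then have "K \<le> M" unfolding K_def by (rule Least_le)
    with M show False by simp
  qed
  then have "\<forall>v\<in>V. (X ^^ K) v = 0" by (simp add: a)
  then show ?thesis ..
qed

end

section \<open>Strings below a weight basis of the kernel of \<open>X\<close>\<close>

locale sl2_hw = sl2_module X Y Z V B for X Y Z :: "'a::real_vector \<Rightarrow> 'a" and V B +
  fixes I :: "'i set" and e :: "'i \<Rightarrow> 'a" and w :: "'i \<Rightarrow> nat"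
  assumes finI: "finite I" and eV: "i \<in> I \<Longrightarrow> e i \<in> V" and Xe: "i \<in> I \<Longrightarrow> X (e i) = 0"
    and Ze: "i \<in> I \<Longrightarrow> Z (e i) = real (w i) *\<^sub>R e i"
    and indep: "(\<Sum>i\<in>I. c i *\<^sub>R e i) = 0 \<Longrightarrow> i \<in> I \<Longrightarrow> c i = 0"
    and ker_span: "v \<in> V \<Longrightarrow> X v = 0 \<Longrightarrow> \<exists>c. v = (\<Sum>i\<in>I. c i *\<^sub>R e i)"
begin

text \<open>Downward induction on a bound \<open>m\<close> for the levels that occur:
  \<open>X ^^ m\<close> kills the levels below \<open>m\<close> and sends level \<open>m\<close> to
  nonzero multiples of the \<open>e i\<close>, whose independence removes that level.\<close>

lemma chains_independent_aux:
  assumes "\<And>i j. i \<in> I \<Longrightarrow> j \<le> w i \<Longrightarrow> m \<le> j \<Longrightarrow> c i j = 0"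
    and "(\<Sum>i\<in>I. \<Sum>j\<le>w i. c i j *\<^sub>R (Y ^^ j) (e i)) = 0"
    and "i \<in> I" "j \<le> w i"
  shows "c i j = 0"
  using assms
proof (induction m)
  case (Suc m)
  have term_eq: "(X ^^ m) (c i j *\<^sub>R (Y ^^ j) (e i)) = (if j = m then (c i m * hwc (w i) m) *\<^sub>R e i else 0)"
    if "i \<in> I" "j \<le> w i" for i j
  proof -
    consider "j < m" | "j = m" | "m < j" by linarith
    then show ?thesis
    proof cases
      case 1 then show ?thesis using Xpow_Ypow_less[OF Xe Ze, of i j m] that by (simp add: Xns)
    next
      case 2 then show ?thesis using Xpow_Ypow_same[OF Xe Ze, of i m] that by (simp add: Xns)
    next
      case 3 then show ?thesis using Suc.prems(1)[of i j] that by (simp add: Xns)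
    qed
  qed
  have "0 = (X ^^ m) (\<Sum>i\<in>I. \<Sum>j\<le>w i. c i j *\<^sub>R (Y ^^ j) (e i))"
    by (simp add: Suc.prems(2) Xns)
  also have "\<dots> = (\<Sum>i\<in>I. \<Sum>j\<le>w i. (X ^^ m) (c i j *\<^sub>R (Y ^^ j) (e i)))"
    by (simp only: Xns)
  also have "\<dots> = (\<Sum>i\<in>I. \<Sum>j\<le>w i. if j = m then (c i m * hwc (w i) m) *\<^sub>R e i else 0)"
    by (intro sum.cong refl term_eq) auto
  also have "\<dots> = (\<Sum>i\<in>I. (if m \<le> w i then c i m * hwc (w i) m else 0) *\<^sub>R e i)"
    by (intro sum.cong refl) simp
  finally have "(if m \<le> w i then c i m * hwc (w i) m else 0) = 0" if "i \<in> I" for i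
    using indep[OF _ that, of "\<lambda>i. if m \<le> w i then c i m * hwc (w i) m else 0"] by simp
  then have "c i m = 0" if "i \<in> I" "m \<le> w i" for i
    using that hwc_nz[of m "w i"] by fastforce
  then have "c i j = 0" if "i \<in> I" "j \<le> w i" "m \<le> j" for i j
    using Suc.prems(1) that by (metis le_antisym not_less_eq_eq)
  then show ?case using Suc.IH Suc.prems by blast
qed simp

lemma chains_independent:
  assumes "(\<Sum>i\<in>I. \<Sum>j\<le>w i. c i j *\<^sub>R (Y ^^ j) (e i)) = 0" "i \<in> I" "j \<le> w i"
  shows "c i j = 0"
proof -
  \<comment> \<open>This exceeds every weight, so no level at or above \<open>m\<close>
    occurs.\<close>
  define m where "m = Suc (Max (w ` I))"
  have "\<not> m \<le> j" if "i \<in> I" "j \<le> w i" for i j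
    using that Max_ge[OF finite_imageI[OF finI] imageI, of i w] unfolding m_def by linarith
  then show ?thesis using chains_independent_aux[of m c i j] assms by blast
qed

text \<open>If \<open>u\<close> lies in the kernel of \<open>X\<^sup>N\<^sup>+\<^sup>1\<close>, then \<open>X\<^sup>N\<^sup>+\<^sup>1 Y u = (N + 1) (Z - N) X\<^sup>N u\<close>. Iterating from \<open>N = m\<close>
  until \<open>X\<^sup>N = 0\<close> shows that \<open>(Z - m) (Z - m - 1) \<dots>\<close> annihilates \<open>X\<^sup>m v\<close>.\<close>
lemma weight_ge:
  assumes v: "v \<in> V" and f: "(X ^^ m) v = (\<Sum>i\<in>I. d i *\<^sub>R e i)" and i: "i \<in> I" and less: "w i < m"
  shows "d i = 0"
proof -
  have step: "\<exists>u\<in>V. (X ^^ (m + n)) u = (\<Sum>i\<in>I. (d i * (\<Prod>t<n. real (w i) - real (m + t))) *\<^sub>R e i)" for n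
  proof (induction n)
    case 0 then show ?case using v f by auto
  next
    case (Suc n)
    let ?c = "\<lambda>i. d i * (\<Prod>t<n. real (w i) - real (m + t))"
    let ?N = "m + n"
    obtain u where u: "u \<in> V" "(X ^^ ?N) u = (\<Sum>i\<in>I. ?c i *\<^sub>R e i)" using Suc.IH by blast
    have "X ((X ^^ ?N) u) = 0" by (simp add: u(2) Xs Xe)
    then have "(X ^^ Suc ?N) (Y u) = real (Suc ?N) *\<^sub>R (Z ((X ^^ ?N) u) - real ?N *\<^sub>R (X ^^ ?N) u)"
      by (subst Xpow_Y) (simp add: Ys)
    also have "Z ((X ^^ ?N) u) - real ?N *\<^sub>R (X ^^ ?N) u
       = (\<Sum>i\<in>I. (?c i * (real (w i) - real ?N)) *\<^sub>R e i)"
      unfolding u(2) by (simp add: Zs Ze scaleR_sum_right sum_subtractf[symmetric] algebra_simps)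
    finally have "(X ^^ Suc ?N) ((1 / real (Suc ?N)) *\<^sub>R Y u) = (\<Sum>i\<in>I. (?c i * (real (w i) - real ?N)) *\<^sub>R e i)"
      unfolding Xns by simp
    moreover have "(1 / real (Suc ?N)) *\<^sub>R Y u \<in> V"
      using u(1) YV subV by (auto intro: subspace_scale)
    ultimately show ?case by (intro bexI[of _ "(1 / real (Suc ?N)) *\<^sub>R Y u"]) (simp_all add: mult.assoc)
  qed
  obtain K where K: "\<forall>v\<in>V. (X ^^ K) v = 0" using X_nilpotent by blast
  obtain u where u: "u \<in> V" "(X ^^ (m + K)) u = (\<Sum>i\<in>I. (d i * (\<Prod>t<K. real (w i) - real (m + t))) *\<^sub>R e i)"
    using step by blast
  have "(X ^^ (m + K)) u = 0" using K u(1) by (simp add: funpow_add Xns)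
  then have "d i * (\<Prod>t<K. real (w i) - real (m + t)) = 0"
    using indep[OF _ i, of "\<lambda>i. d i * (\<Prod>t<K. real (w i) - real (m + t))"] u(2) by simp
  \<comment> \<open>Every factor is negative because \<open>w i < m\<close>.\<close>
  moreover have "(\<Prod>t<K. real (w i) - real (m + t)) \<noteq> 0" using less by auto
  ultimately show ?thesis by simp
qed

text \<open>\<open>(X ^^ m) v\<close> lies in the kernel of \<open>X\<close>, and by
  \<open>weight_ge\<close> only those \<open>e i\<close> occur whose string reaches level
  \<open>m\<close>. Subtracting suitable multiples of \<open>(Y ^^ m) (e i)\<close> lowers
  \<open>m\<close>. The bound on \<open>j\<close> later becomes the admissibility bound on
  \<open>s\<close>.\<close>

lemma ker_Xpow_chains:
  assumes "v \<in> V" "(X ^^ m) v = 0"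
  shows "\<exists>c. v = (\<Sum>i\<in>I. \<Sum>j\<le>w i. c i j *\<^sub>R (Y ^^ j) (e i)) \<and> (\<forall>i. \<forall>j\<ge>m. c i j = 0)"
  using assms
proof (induction m arbitrary: v)
  case 0 then show ?case by (intro exI[of _ "\<lambda>_ _. 0"]) simp
next
  case (Suc m)
  have "X ((X ^^ m) v) = 0" using Suc.prems(2) by simp
  from ker_span[OF XnV[OF Suc.prems(1)] this] obtain d where d: "(X ^^ m) v = (\<Sum>i\<in>I. d i *\<^sub>R e i)" by blast
  have d0: "d i = 0" if "i \<in> I" "w i < m" for i using weight_ge[OF Suc.prems(1) d that] .
  \<comment> \<open>Strings that end before level \<open>m\<close> get 0; there \<open>d i\<close>
    vanishes anyway.\<close>
  define g where "g i = (if m \<le> w i then d i / hwc (w i) m else 0)" for i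
  define u where "u = v - (\<Sum>i\<in>I. g i *\<^sub>R (Y ^^ m) (e i))"
  have "(\<Sum>i\<in>I. g i *\<^sub>R (Y ^^ m) (e i)) \<in> V"
    using subV eV YnV by (intro subspace_sum subspace_scale) auto
  then have uV: "u \<in> V" unfolding u_def using subV Suc.prems(1) by (intro subspace_diff)
  have "(X ^^ m) u = (\<Sum>i\<in>I. d i *\<^sub>R e i) - (\<Sum>i\<in>I. (g i * hwc (w i) m) *\<^sub>R e i)"
    unfolding u_def by (simp add: Xns d Xpow_Ypow_same[OF Xe Ze])
  also have "\<dots> = 0"
    using d0 hwc_nz by (auto simp: g_def intro!: sum.cong)
  finally obtain c where c: "u = (\<Sum>i\<in>I. \<Sum>j\<le>w i. c i j *\<^sub>R (Y ^^ j) (e i))" "\<forall>i. \<forall>j\<ge>m. c i j = 0"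
    using Suc.IH[OF uV] by blast
  have "v = u + (\<Sum>i\<in>I. g i *\<^sub>R (Y ^^ m) (e i))" by (simp add: u_def)
  also have "(\<Sum>i\<in>I. g i *\<^sub>R (Y ^^ m) (e i)) = (\<Sum>i\<in>I. \<Sum>j\<le>w i. (if j = m then g i else 0) *\<^sub>R (Y ^^ j) (e i))"
  proof (rule sum.cong[OF refl])
    fix i
    have "(\<Sum>j\<le>w i. (if j = m then g i else 0) *\<^sub>R (Y ^^ j) (e i))
       = (\<Sum>j\<le>w i. if j = m then g i *\<^sub>R (Y ^^ m) (e i) else 0)"
      by (intro sum.cong) auto
    also have "\<dots> = g i *\<^sub>R (Y ^^ m) (e i)" by (auto simp: g_def)
    finally show "g i *\<^sub>R (Y ^^ m) (e i) = (\<Sum>j\<le>w i. (if j = m then g i else 0) *\<^sub>R (Y ^^ j) (e i))" ..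
  qed
  also have "u + \<dots> = (\<Sum>i\<in>I. \<Sum>j\<le>w i. (c i j + (if j = m then g i else 0)) *\<^sub>R (Y ^^ j) (e i))"
    unfolding c(1) by (simp add: sum.distrib scaleR_add_left)
  finally show ?case using c(2) by (intro exI[of _ "\<lambda>i j. c i j + (if j = m then g i else 0)"]) auto
qed

lemma chains_span:
  assumes "v \<in> V" shows "\<exists>c. v = (\<Sum>i\<in>I. \<Sum>j\<le>w i. c i j *\<^sub>R (Y ^^ j) (e i))"
  using X_nilpotent ker_Xpow_chains assms by blast

end

section \<open>Highest weight vectors of a tensor product\<close>

definition tcoef :: "nat \<Rightarrow> nat \<Rightarrow> nat \<Rightarrow> nat \<Rightarrow> real" where
  "tcoef u v s j = (-1)^j * real (s choose j) * (fact (u - j) / fact (u - s))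
     * (fact (v - s + j) / fact (v - s))"

lemma tcoef_0_nz: "tcoef u v s 0 \<noteq> 0"
  by (simp add: tcoef_def)

text \<open>The factors are those of \<open>X\<close> acting on \<open>Y^(j+1) f\<close> and on
  \<open>Y^(s-j) g\<close>; both produce \<open>Y^j f\<close> times \<open>Y^(s-j-1) g\<close>, so
  this is the cancellation that makes a transvectant invariant.\<close>

lemma tcoef_rec:
  assumes "j < s" "s \<le> u"
  shows "tcoef u v s (Suc j) * (real (Suc j) * (real u - real j))
       + tcoef u v s j * (real (s - j) * real (v - s + Suc j)) = 0"
proof -
  have 1: "fact (u - j) = (real u - real j) * fact (u - Suc j)"
    using assms by (subst fact_reduce) (auto simp: of_nat_diff)
  have 2: "fact (v - s + Suc j) = real (v - s + Suc j) * fact (v - s + j)"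
    by (simp add: algebra_simps)
  have "Suc j * (s choose Suc j) = (s - j) * (s choose j)"
    using assms(1) by (metis Suc_times_binomial_eq binomial_absorption binomial_absorb_comp choose_reduce_nat mult.commute)
  then have 3: "real (Suc j) * real (s choose Suc j) = real (s - j) * real (s choose j)"
    by (metis of_nat_mult)
  have "tcoef u v s (Suc j) * (real (Suc j) * (real u - real j))
      = (-1) ^ Suc j * (real (Suc j) * real (s choose Suc j)) * ((real u - real j) * fact (u - Suc j) / fact (u - s))
        * (fact (v - s + Suc j) / fact (v - s))"
    by (simp add: tcoef_def)
  also have "\<dots> = - (tcoef u v s j * (real (s - j) * real (v - s + Suc j)))"
    unfolding 3 1[symmetric] 2 tcoef_def by simp
  finally show ?thesis by simp
qed

text \<open>Since \<open>V1\<close> and \<open>V2\<close> contain all functions supported on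
  \<open>S1\<close> and \<open>S2\<close>, an element of the tensor product is just a two-argument
  function supported on the product set.\<close>

locale sl2_pair =
  A: sl2_hw X1 Y1 Z1 V1 B1 I1 e1 w1 + B: sl2_hw X2 Y2 Z2 V2 B2 I2 e2 w2
  for X1 Y1 Z1 :: "('a \<Rightarrow> real) \<Rightarrow> 'a \<Rightarrow> real" and V1 B1 and I1 :: "'i set" and e1 w1
    and X2 Y2 Z2 :: "('b \<Rightarrow> real) \<Rightarrow> 'b \<Rightarrow> real" and V2 B2 and I2 :: "'j set" and e2 w2 +
  fixes S1 S2
  assumes V1_eq: "V1 = {h. \<forall>x. x \<notin> S1 \<longrightarrow> h x = 0}" and V2_eq: "V2 = {h. \<forall>x. x \<notin> S2 \<longrightarrow> h x = 0}"
begin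

definition inv :: "('a \<Rightarrow> 'b \<Rightarrow> real) \<Rightarrow> bool" where
  "inv f \<longleftrightarrow> (\<forall>a b. X1 (\<lambda>a. f a b) a + X2 (f a) b = 0)"

definition tv :: "'i \<Rightarrow> 'j \<Rightarrow> nat \<Rightarrow> 'a \<Rightarrow> 'b \<Rightarrow> real" where
  "tv k l s a b = (\<Sum>j\<le>s. tcoef (w1 k) (w2 l) s j * ((Y1 ^^ j) (e1 k) a * (Y2 ^^ (s - j)) (e2 l) b))"

definition T :: "('i \<times> 'j \<times> nat) set" where
  "T = {(k, l, s). k \<in> I1 \<and> l \<in> I2 \<and> s \<le> w1 k \<and> s \<le> w2 l}"

lemma inv_diff:
  assumes "inv f" "inv g" shows "inv (\<lambda>a b. f a b - g a b)"
  unfolding inv_def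
proof (intro allI)
  fix a b
  have "X1 (\<lambda>a. f a b - g a b) = X1 (\<lambda>a. f a b) - X1 (\<lambda>a. g a b)"
    using A.Xs(5)[of "\<lambda>a. f a b" "\<lambda>a. g a b"] unfolding fun_diff_def .
  moreover have "X2 (\<lambda>b. f a b - g a b) = X2 (f a) - X2 (g a)"
    using B.Xs(5)[of "f a" "g a"] unfolding fun_diff_def .
  moreover have "X1 (\<lambda>a. f a b) a + X2 (f a) b = 0" "X1 (\<lambda>a. g a b) a + X2 (g a) b = 0"
    using assms unfolding inv_def by blast+
  ultimately show "X1 (\<lambda>a. f a b - g a b) a + X2 (\<lambda>b. f a b - g a b) b = 0"
    by (simp add: fun_diff_def)
qed

lemma inv_sum:
  assumes "\<And>t. t \<in> S \<Longrightarrow> inv (f t)" shows "inv (\<lambda>a b. \<Sum>t\<in>S. c t * f t a b)"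
proof -
  have "(\<lambda>a. \<Sum>t\<in>S. c t * f t a b) = (\<Sum>t\<in>S. c t *\<^sub>R (\<lambda>a. f t a b))"
       "(\<lambda>b. \<Sum>t\<in>S. c t * f t a b) = (\<Sum>t\<in>S. c t *\<^sub>R f t a)" for a b
    by (auto simp: fun_eq_iff sum_apply)
  then show ?thesis
    using assms by (simp add: inv_def A.Xs B.Xs sum_apply sum.distrib[symmetric] distrib_left[symmetric])
qed

text \<open>Both operators map the sum to products with total exponent \<open>s - 1\<close>; each
  such product receives one contribution from either side, and the two cancel by
  \<open>tcoef_rec\<close>.\<close>

lemma tv_inv:
  assumes k: "k \<in> I1" and l: "l \<in> I2" and s1: "s \<le> w1 k" and s2: "s \<le> w2 l"
  shows "inv (tv k l s)"
  unfolding inv_def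
proof (intro allI)
  fix a b
  let ?c = "tcoef (w1 k) (w2 l) s"
  let ?P = "\<lambda>j. (Y1 ^^ j) (e1 k)" and ?Q = "\<lambda>j. (Y2 ^^ j) (e2 l)"
  have "(\<lambda>a. tv k l s a b) = (\<Sum>j\<le>s. (?c j * ?Q (s - j) b) *\<^sub>R ?P j)"
    by (auto simp: tv_def fun_eq_iff sum_apply intro!: sum.cong)
  then have "X1 (\<lambda>a. tv k l s a b) a = (\<Sum>j<Suc s. ?c j * ?Q (s - j) b * X1 (?P j) a)"
    by (simp add: A.Xs sum_apply lessThan_Suc_atMost)
  \<comment> \<open>The term \<open>j = 0\<close> drops out because \<open>X1\<close> kills
    \<open>e1 k\<close>; dually \<open>X2\<close> kills the term \<open>j = s\<close> below.\<close>
  also have "\<dots> = (\<Sum>j<s. ?c (Suc j) * ?Q (s - Suc j) b * X1 (?P (Suc j)) a)"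
    by (subst sum.lessThan_Suc_shift) (simp add: A.Xe[OF k])
  also have "\<dots> = (\<Sum>j<s. ?c (Suc j) * (real (Suc j) * (real (w1 k) - real j)) * (?P j a * ?Q (s - Suc j) b))"
    unfolding A.X_Ypow_Suc[OF A.Xe[OF k] A.Ze[OF k]] by (intro sum.cong) auto
  finally have 1: "X1 (\<lambda>a. tv k l s a b) a = \<dots>" .
  have "tv k l s a = (\<Sum>j\<le>s. (?c j * ?P j a) *\<^sub>R ?Q (s - j))"
    by (auto simp: tv_def fun_eq_iff sum_apply intro!: sum.cong)
  then have "X2 (tv k l s a) b = (\<Sum>j<Suc s. ?c j * ?P j a * X2 (?Q (s - j)) b)"
    by (simp add: B.Xs sum_apply lessThan_Suc_atMost)
  also have "\<dots> = (\<Sum>j<s. ?c j * ?P j a * X2 (?Q (s - j)) b)"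
    by (simp add: B.Xe[OF l])
  also have "\<dots> = (\<Sum>j<s. ?c j * (real (s - j) * real (w2 l - s + Suc j)) * (?P j a * ?Q (s - Suc j) b))"
  proof (rule sum.cong[OF refl])
    fix j assume "j \<in> {..<s}"
    then have s: "s - j = Suc (s - Suc j)" by auto
    have "real (w2 l) - real (s - Suc j) = real (w2 l - s + Suc j)"
      using \<open>j \<in> {..<s}\<close> s2 by auto
    then show "?c j * ?P j a * X2 (?Q (s - j)) b
        = ?c j * (real (s - j) * real (w2 l - s + Suc j)) * (?P j a * ?Q (s - Suc j) b)"
      unfolding s B.X_Ypow_Suc[OF B.Xe[OF l] B.Ze[OF l]] by simp
  qed
  finally have 2: "X2 (tv k l s a) b = \<dots>" .
  show "X1 (\<lambda>a. tv k l s a b) a + X2 (tv k l s a) b = 0"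
    unfolding 1 2 sum.distrib[symmetric] distrib_right[symmetric]
    using tcoef_rec[OF _ s1, of _ "w2 l"] by (intro sum.neutral ballI) simp
qed

text \<open>The coefficient of \<open>(Y1 ^^ j) (e1 k)\<close> when the combination of transvectants
  with coefficients \<open>D\<close> is sorted by strings of the first factor.\<close>

definition G :: "('i \<Rightarrow> 'j \<Rightarrow> nat \<Rightarrow> real) \<Rightarrow> 'i \<Rightarrow> nat \<Rightarrow> 'b \<Rightarrow> real" where
  "G D k j b = (\<Sum>l\<in>I2. \<Sum>s\<le>w2 l.
      if j \<le> s then D k l s * tcoef (w1 k) (w2 l) s j * (Y2 ^^ (s - j)) (e2 l) b else 0)"

lemma tv_expand:
  assumes D: "\<And>k l s. w1 k < s \<Longrightarrow> D k l s = 0"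
  shows "(\<Sum>k\<in>I1. \<Sum>l\<in>I2. \<Sum>s\<le>w2 l. D k l s * tv k l s a b)
       = (\<Sum>k\<in>I1. \<Sum>j\<le>w1 k. (Y1 ^^ j) (e1 k) a * G D k j b)"
proof (rule sum.cong[OF refl])
  fix k
  let ?h = "\<lambda>l s j. if j \<le> s then D k l s * tcoef (w1 k) (w2 l) s j * (Y2 ^^ (s - j)) (e2 l) b else 0"
  have "D k l s * tv k l s a b = (\<Sum>j\<le>w1 k. (Y1 ^^ j) (e1 k) a * ?h l s j)" for l s
  proof (cases "s \<le> w1 k")
    case True
    have "D k l s * tv k l s a b = (\<Sum>j\<le>s. (Y1 ^^ j) (e1 k) a * ?h l s j)"
      unfolding tv_def sum_distrib_left by (intro sum.cong) auto
    also have "\<dots> = (\<Sum>j\<le>w1 k. (Y1 ^^ j) (e1 k) a * ?h l s j)"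
      using True by (intro sum.mono_neutral_left) auto
    finally show ?thesis .
  next
    case False
    then show ?thesis using D[of k s l] by (auto intro!: sum.neutral[symmetric])
  qed
  then have "(\<Sum>l\<in>I2. \<Sum>s\<le>w2 l. D k l s * tv k l s a b)
      = (\<Sum>l\<in>I2. \<Sum>s\<le>w2 l. \<Sum>j\<le>w1 k. (Y1 ^^ j) (e1 k) a * ?h l s j)"
    by simp
  also have "\<dots> = (\<Sum>l\<in>I2. \<Sum>j\<le>w1 k. \<Sum>s\<le>w2 l. (Y1 ^^ j) (e1 k) a * ?h l s j)"
    by (intro sum.cong refl sum.swap)
  also have "\<dots> = (\<Sum>j\<le>w1 k. \<Sum>l\<in>I2. \<Sum>s\<le>w2 l. (Y1 ^^ j) (e1 k) a * ?h l s j)"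
    by (rule sum.swap)
  also have "\<dots> = (\<Sum>j\<le>w1 k. (Y1 ^^ j) (e1 k) a * G D k j b)"
    unfolding G_def sum_distrib_left ..
  finally show "(\<Sum>l\<in>I2. \<Sum>s\<le>w2 l. D k l s * tv k l s a b)
      = (\<Sum>j\<le>w1 k. (Y1 ^^ j) (e1 k) a * G D k j b)" .
qed

lemma chains_coeff_zero:
  assumes "\<And>a. (\<Sum>k\<in>I1. \<Sum>j\<le>w1 k. (Y1 ^^ j) (e1 k) a * c k j) = 0" "k \<in> I1" "j \<le> w1 k"
  shows "c k j = 0"
proof -
  have "(\<Sum>k\<in>I1. \<Sum>j\<le>w1 k. c k j *\<^sub>R (Y1 ^^ j) (e1 k)) = 0"
    using assms(1) by (auto simp: fun_eq_iff sum_apply mult.commute)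
  then show ?thesis by (rule A.chains_independent) fact+
qed

text \<open>Level 0 suffices: there each transvectant contributes \<open>(Y2 ^^ s) (e2 l)\<close>
  with the nonzero factor \<open>tcoef (w1 k) (w2 l) s 0\<close>, and these vectors are
  independent.\<close>

lemma tv_independent:
  assumes D: "\<And>k l s. w1 k < s \<Longrightarrow> D k l s = 0"
    and 0: "\<And>a b. (\<Sum>k\<in>I1. \<Sum>l\<in>I2. \<Sum>s\<le>w2 l. D k l s * tv k l s a b) = 0"
    and kls: "k \<in> I1" "l \<in> I2" "s \<le> w2 l"
  shows "D k l s = 0"
proof -
  have "G D k 0 b = 0" for b
    using chains_coeff_zero[of "\<lambda>k j. G D k j b" k 0] 0 kls(1) by (simp add: tv_expand[OF D])
  then have "(\<Sum>l\<in>I2. \<Sum>s\<le>w2 l. (D k l s * tcoef (w1 k) (w2 l) s 0) *\<^sub>R (Y2 ^^ s) (e2 l)) = 0"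
    by (auto simp: G_def fun_eq_iff sum_apply)
  then have "D k l s * tcoef (w1 k) (w2 l) s 0 = 0"
    by (rule B.chains_independent[where c = "\<lambda>l s. D k l s * tcoef (w1 k) (w2 l) s 0"]) fact+
  then show ?thesis using tcoef_0_nz by simp
qed

text \<open>Compare coefficients of \<open>(Y1 ^^ j) (e1 k)\<close>: \<open>X1\<close> moves level
  \<open>j + 1\<close> down to level \<open>j\<close>, while \<open>X2\<close> acts on the
  coefficient itself. At \<open>j = w1 k\<close> the factor is zero, so the value of
  \<open>g\<close> beyond the string is irrelevant.\<close>

lemma chain_recurrence:
  assumes f: "\<And>a b. f a b = (\<Sum>k\<in>I1. \<Sum>j\<le>w1 k. (Y1 ^^ j) (e1 k) a * g k j b)"
    and inv: "inv f" and k: "k \<in> I1" "j \<le> w1 k"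
  shows "X2 (g k j) = - (real (Suc j) * (real (w1 k) - real j)) *\<^sub>R g k (Suc j)"
proof
  fix b
  let ?r = "\<lambda>k j. real (Suc j) * (real (w1 k) - real j)"
  have X1: "X1 (\<lambda>a. f a b) a = (\<Sum>k\<in>I1. \<Sum>j\<le>w1 k. (Y1 ^^ j) (e1 k) a * (?r k j * g k (Suc j) b))" for a
  proof -
    have "(\<lambda>a. f a b) = (\<Sum>k\<in>I1. \<Sum>j\<le>w1 k. g k j b *\<^sub>R (Y1 ^^ j) (e1 k))"
      by (auto simp: f fun_eq_iff sum_apply mult.commute)
    then have "X1 (\<lambda>a. f a b) a = (\<Sum>k\<in>I1. \<Sum>j\<le>w1 k. g k j b * X1 ((Y1 ^^ j) (e1 k)) a)"
      by (simp add: A.Xs sum_apply)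
    also have "\<dots> = (\<Sum>k\<in>I1. \<Sum>j\<le>w1 k. (Y1 ^^ j) (e1 k) a * (?r k j * g k (Suc j) b))"
    proof (rule sum.cong[OF refl])
      fix k assume k: "k \<in> I1"
      have "(\<Sum>j\<le>w1 k. g k j b * X1 ((Y1 ^^ j) (e1 k)) a) = (\<Sum>j<Suc (w1 k). g k j b * X1 ((Y1 ^^ j) (e1 k)) a)"
        by (simp only: lessThan_Suc_atMost)
      also have "\<dots> = (\<Sum>j<w1 k. g k (Suc j) b * X1 ((Y1 ^^ Suc j) (e1 k)) a)"
        by (subst sum.lessThan_Suc_shift) (simp add: A.Xe[OF k])
      also have "\<dots> = (\<Sum>j<w1 k. (Y1 ^^ j) (e1 k) a * (?r k j * g k (Suc j) b))"
        unfolding A.X_Ypow_Suc[OF A.Xe[OF k] A.Ze[OF k]] by (intro sum.cong) auto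
      \<comment> \<open>The added term \<open>j = w1 k\<close> carries the factor 0.\<close>
      also have "\<dots> = (\<Sum>j<Suc (w1 k). (Y1 ^^ j) (e1 k) a * (?r k j * g k (Suc j) b))"
        by simp
      finally show "(\<Sum>j\<le>w1 k. g k j b * X1 ((Y1 ^^ j) (e1 k)) a)
          = (\<Sum>j\<le>w1 k. (Y1 ^^ j) (e1 k) a * (?r k j * g k (Suc j) b))"
        by (simp only: lessThan_Suc_atMost)
    qed
    finally show ?thesis .
  qed
  have X2: "X2 (f a) b = (\<Sum>k\<in>I1. \<Sum>j\<le>w1 k. (Y1 ^^ j) (e1 k) a * X2 (g k j) b)" for a
  proof -
    have "f a = (\<Sum>k\<in>I1. \<Sum>j\<le>w1 k. (Y1 ^^ j) (e1 k) a *\<^sub>R g k j)"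
      by (auto simp: f fun_eq_iff sum_apply)
    then show ?thesis by (simp add: B.Xs sum_apply)
  qed
  have "(\<Sum>k\<in>I1. \<Sum>j\<le>w1 k. (Y1 ^^ j) (e1 k) a * (?r k j * g k (Suc j) b + X2 (g k j) b)) = 0" for a
    using inv[unfolded inv_def, THEN spec[of _ a], THEN spec[of _ b]] unfolding X1 X2 by (simp only: distrib_left sum.distrib)
  from chains_coeff_zero[OF this k]
  show "X2 (g k j) b = (- ?r k j *\<^sub>R g k (Suc j)) b" by simp
qed

text \<open>Up to scalars, \<open>X2\<close> walks along the coefficients of a string from
  \<open>g k 0\<close> to \<open>g k (w1 k)\<close>, and one more step gives 0.\<close>

lemma chain_top_nilpotent:
  assumes f: "\<And>a b. f a b = (\<Sum>k\<in>I1. \<Sum>j\<le>w1 k. (Y1 ^^ j) (e1 k) a * g k j b)"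
    and inv: "inv f" and k: "k \<in> I1"
  shows "(X2 ^^ Suc (w1 k)) (g k 0) = 0"
proof -
  note rec = chain_recurrence[OF f inv k]
  have "\<exists>c. (X2 ^^ j) (g k 0) = c *\<^sub>R g k j" if "j \<le> w1 k" for j
    using that
  proof (induction j)
    case 0 show ?case by (rule exI[of _ 1]) simp
  next
    case (Suc j)
    from Suc.prems have j: "j \<le> w1 k" by simp
    from Suc.IH[OF j] obtain c where c: "(X2 ^^ j) (g k 0) = c *\<^sub>R g k j" ..
    have "(X2 ^^ Suc j) (g k 0) = (c * - (real (Suc j) * (real (w1 k) - real j))) *\<^sub>R g k (Suc j)"
      by (simp only: funpow.simps o_apply c B.Xs rec[OF j] scaleR_scaleR)
    then show ?case ..
  qed
  then obtain c where c: "(X2 ^^ w1 k) (g k 0) = c *\<^sub>R g k (w1 k)" by blast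
  have "X2 (g k (w1 k)) = 0" using rec[OF order_refl] by simp
  then show ?thesis by (simp only: funpow.simps o_apply c B.Xs scaleR_zero_right)
qed

text \<open>For \<open>j < w1 k\<close> the factor in the recurrence is nonzero, so
  \<open>g k j\<close> determines \<open>g k (Suc j)\<close>.\<close>

lemma inv_zero:
  assumes f: "\<And>a b. f a b = (\<Sum>k\<in>I1. \<Sum>j\<le>w1 k. (Y1 ^^ j) (e1 k) a * g k j b)"
    and inv: "inv f" and g0: "\<And>k. k \<in> I1 \<Longrightarrow> g k 0 = 0"
  shows "f a b = 0"
proof -
  have "g k j = 0" if k: "k \<in> I1" and "j \<le> w1 k" for k j
    using that(2)
  proof (induction j)
    case 0 then show ?case by (simp add: g0 k)
  next
    case (Suc j)
    have "- (real (Suc j) * (real (w1 k) - real j)) *\<^sub>R g k (Suc j) = X2 (g k j)"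
      by (rule chain_recurrence[OF f inv k, symmetric]) (use Suc.prems in simp)
    also have "g k j = 0" by (rule Suc.IH) (use Suc.prems in simp)
    finally have "- (real (Suc j) * (real (w1 k) - real j)) *\<^sub>R g k (Suc j) = 0"
      by (simp only: B.Xs)
    moreover have "- (real (Suc j) * (real (w1 k) - real j)) \<noteq> 0" using Suc.prems by simp
    ultimately show ?case by (simp only: scaleR_eq_0_iff) simp
  qed
  then show ?thesis by (simp add: f)
qed

text \<open>Match the level-0 coefficients of \<open>f\<close> by a combination \<open>h\<close> of
  transvectants; then \<open>f - h\<close> is invariant with zero level-0 coefficients, and
  \<open>inv_zero\<close> applies.\<close>

lemma tv_span:
  assumes S: "\<And>a b. a \<notin> S1 \<or> b \<notin> S2 \<Longrightarrow> f a b = 0" and inv: "inv f"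
  shows "\<exists>D. (\<forall>k l s. w1 k < s \<longrightarrow> D k l s = 0) \<and>
     (\<forall>a b. f a b = (\<Sum>k\<in>I1. \<Sum>l\<in>I2. \<Sum>s\<le>w2 l. D k l s * tv k l s a b))"
proof -
  \<comment> \<open>Expand each slice with \<open>b\<close> fixed; the coefficients, as functions of
    \<open>b\<close>, become the \<open>g k j\<close>.\<close>
  have "\<forall>b. \<exists>c. (\<lambda>a. f a b) = (\<Sum>k\<in>I1. \<Sum>j\<le>w1 k. c k j *\<^sub>R (Y1 ^^ j) (e1 k))"
    by (intro allI A.chains_span) (simp add: V1_eq S)
  from choice[OF this] obtain g0
    where g0: "\<And>b. (\<lambda>a. f a b) = (\<Sum>k\<in>I1. \<Sum>j\<le>w1 k. g0 b k j *\<^sub>R (Y1 ^^ j) (e1 k))"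
    by blast
  define g where "g k j b = g0 b k j" for k j b
  have f: "f a b = (\<Sum>k\<in>I1. \<Sum>j\<le>w1 k. (Y1 ^^ j) (e1 k) a * g k j b)" for a b
    using fun_cong[OF g0[of b], of a] by (simp add: g_def sum_apply mult.commute)
  have gV: "g k j \<in> V2" if "k \<in> I1" "j \<le> w1 k" for k j
  proof -
    have "g k j b = 0" if "b \<notin> S2" for b
      using chains_coeff_zero[of "\<lambda>k j. g k j b", OF _ \<open>k \<in> I1\<close> \<open>j \<le> w1 k\<close>] S that by (simp add: f[symmetric])
    then show ?thesis by (simp add: V2_eq)
  qed
  \<comment> \<open>Nilpotency of order \<open>w1 k + 1\<close> is what restricts the strings of the
    second factor to \<open>s \<le> w1 k\<close>.\<close>
  have "\<forall>k\<in>I1. \<exists>c. g k 0 = (\<Sum>l\<in>I2. \<Sum>s\<le>w2 l. c l s *\<^sub>R (Y2 ^^ s) (e2 l))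
      \<and> (\<forall>l. \<forall>s\<ge>Suc (w1 k). c l s = 0)"
    by (intro ballI B.ker_Xpow_chains gV chain_top_nilpotent[OF f inv] le0)
  from bchoice[OF this] obtain d where d: "\<And>k. k \<in> I1 \<Longrightarrow> g k 0 = (\<Sum>l\<in>I2. \<Sum>s\<le>w2 l. d k l s *\<^sub>R (Y2 ^^ s) (e2 l))"
    and d0: "\<And>k l s. k \<in> I1 \<Longrightarrow> Suc (w1 k) \<le> s \<Longrightarrow> d k l s = 0"
    by blast
  \<comment> \<open>The division undoes the leading coefficient of the transvectant.\<close>
  define D where "D k l s = (if s \<le> w1 k then d k l s / tcoef (w1 k) (w2 l) s 0 else 0)" for k l s
  have D0: "w1 k < s \<Longrightarrow> D k l s = 0" for k l s by (simp add: D_def)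
  define h where "h a b = (\<Sum>k\<in>I1. \<Sum>l\<in>I2. \<Sum>s\<le>w2 l. D k l s * tv k l s a b)" for a b
  have "inv (\<lambda>a b. D k l s * tv k l s a b)" if "k \<in> I1" "l \<in> I2" "s \<le> w2 l" for k l s
  proof (cases "s \<le> w1 k")
    case True
    then show ?thesis using inv_sum[of "{()}" "\<lambda>_. tv k l s" "\<lambda>_. D k l s"] tv_inv that by simp
  next
    case False
    then show ?thesis using inv_sum[of "{}"] by (simp add: D0)
  qed
  \<comment> \<open>The factors 1 fit the nested sums to the weighted form of
    \<open>inv_sum\<close>.\<close>
  then have "inv (\<lambda>a b. \<Sum>k\<in>I1. 1 * (\<Sum>l\<in>I2. 1 * (\<Sum>s\<le>w2 l. 1 * (D k l s * tv k l s a b))))"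
    by (intro inv_sum) auto
  then have "inv h" by (simp add: h_def[abs_def])
  have diff: "f a b - h a b = (\<Sum>k\<in>I1. \<Sum>j\<le>w1 k. (Y1 ^^ j) (e1 k) a * (g k j b - G D k j b))" for a b
  proof -
    have "h a b = (\<Sum>k\<in>I1. \<Sum>j\<le>w1 k. (Y1 ^^ j) (e1 k) a * G D k j b)"
      unfolding h_def by (rule tv_expand) (rule D0)
    then show ?thesis by (simp add: f sum_subtractf right_diff_distrib)
  qed
  have "f a b - h a b = 0" for a b
  proof (rule inv_zero[OF diff])
    show "inv (\<lambda>a b. f a b - h a b)" using inv \<open>inv h\<close> by (rule inv_diff)
    fix k assume k: "k \<in> I1"
    have "G D k 0 b = g k 0 b" for b
      unfolding G_def d[OF k] sum_apply using d0[OF k] tcoef_0_nz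
      by (intro sum.cong refl) (auto simp: D_def not_less_eq_eq)
    then show "(\<lambda>b. g k 0 b - G D k 0 b) = 0" by (simp add: fun_eq_iff)
  qed
  then show ?thesis using D0 by (intro exI[of _ D]) (auto simp: h_def)
qed

lemma sum_T:
  "(\<Sum>(k, l, s)\<in>T. c (k, l, s) * h k l s)
     = (\<Sum>k\<in>I1. \<Sum>l\<in>I2. \<Sum>s\<le>w2 l. (if s \<le> w1 k then c (k, l, s) else 0) * (h k l s :: real))"
proof -
  have "(\<Sum>(k, l, s)\<in>T. c (k, l, s) * h k l s) = (\<Sum>(k, l, s)\<in>T. (if s \<le> w1 k then c (k, l, s) else 0) * h k l s)"
    by (intro sum.cong) (auto simp: T_def)
  also have "\<dots> = (\<Sum>(k, l, s)\<in>(SIGMA k:I1. SIGMA l:I2. {..w2 l}). (if s \<le> w1 k then c (k, l, s) else 0) * h k l s)"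
    using A.finI B.finI by (intro sum.mono_neutral_left) (auto simp: T_def split: if_splits)
  finally show ?thesis using A.finI B.finI by (simp add: sum.Sigma)
qed

lemma finite_T: "finite T"
proof (rule finite_subset)
  show "T \<subseteq> (SIGMA k:I1. SIGMA l:I2. {..w2 l})" by (auto simp: T_def)
qed (use A.finI B.finI in auto)

lemma tv_independent_T:
  assumes 0: "\<And>a b. (\<Sum>(k, l, s)\<in>T. c (k, l, s) * tv k l s a b) = 0" and t: "t \<in> T"
  shows "c t = 0"
proof -
  obtain k l s where kls: "t = (k, l, s)" "k \<in> I1" "l \<in> I2" "s \<le> w1 k" "s \<le> w2 l"
    using t by (auto simp: T_def)
  have "(if s \<le> w1 k then c (k, l, s) else 0) = 0"
  proof (rule tv_independent[where D = "\<lambda>k l s. if s \<le> w1 k then c (k, l, s) else 0"])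
    show "(\<Sum>k\<in>I1. \<Sum>l\<in>I2. \<Sum>s\<le>w2 l. (if s \<le> w1 k then c (k, l, s) else 0) * tv k l s a b) = 0" for a b
      using 0[of a b] unfolding sum_T[of c "\<lambda>k l s. tv k l s a b"] .
  qed (use kls in auto)
  then show ?thesis using kls by simp
qed

lemma tv_span_T:
  assumes "\<And>a b. a \<notin> S1 \<or> b \<notin> S2 \<Longrightarrow> f a b = 0" "inv f"
  shows "\<exists>c. \<forall>a b. f a b = (\<Sum>(k, l, s)\<in>T. c (k, l, s) * tv k l s a b)"
proof -
  obtain D where D: "\<And>k l s. w1 k < s \<Longrightarrow> D k l s = 0"
    "\<And>a b. f a b = (\<Sum>k\<in>I1. \<Sum>l\<in>I2. \<Sum>s\<le>w2 l. D k l s * tv k l s a b)"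
    using tv_span[OF assms] by blast
  have "(if s \<le> w1 k then D k l s else 0) = D k l s" for k l s using D(1) by simp
  then have "f a b = (\<Sum>(k, l, s)\<in>T. (\<lambda>(k, l, s). D k l s) (k, l, s) * tv k l s a b)" for a b
    unfolding D(2) sum_T[of "\<lambda>(k, l, s). D k l s" "\<lambda>k l s. tv k l s a b"] by (simp only: prod.case)
  then show ?thesis by blast
qed

end

section \<open>Homogeneous components\<close>

text \<open>\<open>Dmat\<close> reverses brackets; exchanging the roles of the matrices
  \<open>X\<close> and \<open>Y\<close> compensates for this.\<close>

lemma sl2_ops_Dmat:
  assumes "sl2_triad X Y Z" shows "sl2_ops (Dmat Y) (Dmat X) (Dmat Z)"
proof -
  have XY: "X ** Y - Y ** X = Z" and ZX: "Z ** X - X ** Z = (2::real) *\<^sub>R X"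
    and ZY: "Y ** Z - Z ** Y = (2::real) *\<^sub>R Y"
    using assms unfolding sl2_triad_def by (auto simp: minus_equation_iff[of _ "_ *\<^sub>R _"] algebra_simps)
  show ?thesis
  proof (rule sl2_ops.intro[OF linear_Dmat linear_Dmat linear_Dmat])
    show "Dmat Y (Dmat X v) = Dmat X (Dmat Y v) + Dmat Z v" for v
      using Dmat_commutator[of Y X v] unfolding XY by (simp add: algebra_simps)
    show "Dmat Z (Dmat Y v) = Dmat Y (Dmat Z v) + 2 *\<^sub>R Dmat Y v" for v
      using Dmat_commutator[of Z Y v] unfolding ZY Dmat_scaleR by (simp add: algebra_simps)
    show "Dmat Z (Dmat X v) = Dmat X (Dmat Z v) - 2 *\<^sub>R Dmat X v" for v
      using Dmat_commutator[of X Z v] unfolding ZX Dmat_scaleR by (simp add: algebra_simps)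
  qed
qed

text \<open>The condition is written as a support condition in the shape demanded by
  \<open>sl2_pair\<close>.\<close>

definition degree_part :: "nat \<Rightarrow> 'v::finite mfps set" where
  "degree_part d = {f. \<forall>\<mu>. \<mu> \<notin> {\<mu>. mdeg \<mu> = d} \<longrightarrow> f \<mu> = 0}"

definition monom_basis :: "nat \<Rightarrow> 'v::finite mfps set" where
  "monom_basis d = (\<lambda>\<nu> \<mu>. if \<mu> = \<nu> then 1 else 0) ` {\<nu>. mdeg \<nu> = d}"

lemma finite_monom_basis: "finite (monom_basis d)"
  by (simp add: monom_basis_def finite_mdeg)

lemma degree_part_span: "degree_part d \<subseteq> span (monom_basis d)"
proof
  fix f :: "'a mfps" assume f: "f \<in> degree_part d"
  have "f = (\<Sum>\<nu> | mdeg \<nu> = d. f \<nu> *\<^sub>R (\<lambda>\<mu>. if \<mu> = \<nu> then 1 else 0))"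
  proof
    fix \<mu>
    have "(\<Sum>\<nu> | mdeg \<nu> = d. f \<nu> *\<^sub>R (\<lambda>\<mu>. if \<mu> = \<nu> then 1 else 0)) \<mu>
        = (\<Sum>\<nu> | mdeg \<nu> = d. if \<mu> = \<nu> then f \<nu> else 0)"
      by (simp add: sum_apply if_distrib cong: if_cong)
    also have "\<dots> = f \<mu>"
      using f by (subst sum.delta'[OF finite_mdeg]) (auto simp: degree_part_def)
    finally show "f \<mu> = (\<Sum>\<nu> | mdeg \<nu> = d. f \<nu> *\<^sub>R (\<lambda>\<mu>. if \<mu> = \<nu> then 1 else 0)) \<mu>" ..
  qed
  also have "\<dots> \<in> span (monom_basis d)"
    by (intro span_sum span_scale span_base) (auto simp: monom_basis_def)
  finally show "f \<in> span (monom_basis d)" .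
qed

lemma Dmat_degree_part:
  fixes f :: "'v::finite mfps"
  shows "f \<in> degree_part d \<Longrightarrow> Dmat A f \<in> degree_part d"
  unfolding degree_part_def Dmat_def
proof (intro CollectI allI impI)
  fix \<mu> :: "'v \<Rightarrow> nat"
  assume f: "f \<in> {f. \<forall>\<mu>. \<mu> \<notin> {\<mu>. mdeg \<mu> = d} \<longrightarrow> f \<mu> = 0}" and \<mu>: "\<mu> \<notin> {\<mu>. mdeg \<mu> = d}"
  have "f \<nu> = 0" if "mdeg \<nu> = mdeg \<mu>" for \<nu>
    using f \<mu> that by simp
  then show "Dop (\<lambda>i j. A $ i $ j) f \<mu> = 0" by (rule Dop_zero_apply)
qed

lemma sl2_module_degree_part:
  assumes "sl2_triad X Y Z"
  shows "sl2_module (Dmat Y) (Dmat X) (Dmat Z) (degree_part d) (monom_basis d)"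
proof -
  interpret sl2_ops "Dmat Y" "Dmat X" "Dmat Z" using assms by (rule sl2_ops_Dmat)
  show ?thesis
  proof
    show "subspace (degree_part d :: 'a mfps set)"
      by (rule subspaceI) (auto simp: degree_part_def)
  qed (rule finite_monom_basis degree_part_span Dmat_degree_part; assumption?)+
qed

text \<open>A choice, since the zero series lies in every degree; only membership in the chosen
  degree is used.\<close>

definition hdeg :: "'v::finite mfps \<Rightarrow> nat" where
  "hdeg f = (SOME d. f \<in> degree_part d)"

lemma hdeg:
  assumes "homogeneous f" shows "f \<in> degree_part (hdeg f)"
proof -
  obtain d where "\<forall>\<mu>. f \<mu> \<noteq> 0 \<longrightarrow> mdeg \<mu> = d"
    using assms unfolding homogeneous_def by blast
  then have "f \<in> degree_part d" unfolding degree_part_def by blast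
  then show ?thesis unfolding hdeg_def by (rule someI)
qed

text \<open>Otherwise \<open>card B + 1\<close> of the vectors would be independent inside the span
  of \<open>B\<close>.\<close>

lemma lin_indep_finite:
  fixes F :: "'i \<Rightarrow> 'v mfps"
  assumes "lin_indep A F" "S \<subseteq> A" "finite B" "\<And>k. k \<in> S \<Longrightarrow> F k \<in> span B"
  shows "finite S"
proof (rule ccontr)
  assume "infinite S"
  then obtain R where R: "R \<subseteq> S" "finite R" "card R = Suc (card B)"
    using infinite_arbitrarily_large by blast
  have c0: "\<forall>t\<in>R. c t = 0" if "(\<Sum>t\<in>R. c t *\<^sub>R F t) = 0" for c
  proof -
    have "\<forall>\<mu>. (\<Sum>t\<in>R. c t * F t \<mu>) = 0"
      using that by (auto simp: fun_eq_iff sum_apply)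
    then show ?thesis using assms(1,2) R(1,2) unfolding lin_indep_def by blast
  qed
  have inj: "inj_on F R"
  proof (rule inj_onI, rule ccontr)
    fix x y assume xy: "x \<in> R" "y \<in> R" "F x = F y" "x \<noteq> y"
    let ?c = "\<lambda>t. if t = x then 1 else if t = y then -1 else 0 :: real"
    have "(\<Sum>t\<in>R. ?c t *\<^sub>R F t) = (\<Sum>t\<in>{x, y}. ?c t *\<^sub>R F t)"
      using xy R(2) by (intro sum.mono_neutral_right) auto
    also have "\<dots> = 0" using xy by simp
    finally have "?c x = 0" using c0[of ?c] xy(1) by blast
    then show False by simp
  qed
  have "independent (F ` R)"
  proof (rule independent_if_scalars_zero)
    fix g f assume g: "(\<Sum>f\<in>F ` R. g f *\<^sub>R f) = 0" and f: "f \<in> F ` R"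
    have "(\<Sum>t\<in>R. g (F t) *\<^sub>R F t) = 0" using g by (simp add: sum.reindex[OF inj])
    then show "g f = 0" using c0[of "\<lambda>t. g (F t)"] f by blast
  qed (use R in simp)
  moreover have "F ` R \<subseteq> span B" using R(1) assms(4) by blast
  ultimately have "card (F ` R) \<le> card B" using independent_span_bound[OF assms(3)] by blast
  then show False using R(3) card_image[OF inj] by simp
qed

text \<open>In degree \<open>d\<close> only the finitely many members of degree \<open>d\<close>
  contribute, so a countable combination becomes a finite one and they form a weight basis of the
  kernel there.\<close>

lemma sl2_hw_degree_part:
  fixes X Y Z :: "real^'v::finite^'v" and F :: "'i \<Rightarrow> 'v mfps"
  assumes triad: "sl2_triad X Y Z"
    and hom: "\<And>k. k \<in> A \<Longrightarrow> homogeneous (F k)"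
    and ker: "\<And>k. k \<in> A \<Longrightarrow> Dmat Y (F k) = 0"
    and weight: "\<And>k. k \<in> A \<Longrightarrow> Dmat Z (F k) = real (w k) *\<^sub>R F k"
    and indep: "lin_indep A F"
    and span: "\<And>f. Dmat Y f = 0 \<Longrightarrow> count_lin_comb A F f"
  shows "sl2_hw (Dmat Y) (Dmat X) (Dmat Z) (degree_part d) (monom_basis d) {k\<in>A. hdeg (F k) = d} F w"
proof -
  interpret sl2_module "Dmat Y" "Dmat X" "Dmat Z" "degree_part d" "monom_basis d"
    using triad by (rule sl2_module_degree_part)
  let ?I = "{k\<in>A. hdeg (F k) = d}"
  have FV: "F k \<in> degree_part d" if "k \<in> ?I" for k
    using hdeg[OF hom, of k] that by auto
  have fin: "finite ?I"
  proof (rule lin_indep_finite[OF indep _ finite_monom_basis[of d]])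
    show "F k \<in> span (monom_basis d)" if "k \<in> ?I" for k
      using FV[OF that] by (rule subsetD[OF degree_part_span])
  qed blast
  show ?thesis
  proof
    show "finite ?I" by fact
    show "F k \<in> degree_part d" if "k \<in> ?I" for k using that by (rule FV)
    show "Dmat Y (F k) = 0" if "k \<in> ?I" for k using that ker by simp
    show "Dmat Z (F k) = real (w k) *\<^sub>R F k" if "k \<in> ?I" for k using that by (intro weight) simp
    show "c k = 0" if "(\<Sum>k\<in>?I. c k *\<^sub>R F k) = 0" "k \<in> ?I" for c k
    proof -
      have "\<forall>\<mu>. (\<Sum>k\<in>?I. c k * F k \<mu>) = 0"
        using that(1) by (auto simp: fun_eq_iff sum_apply)
      moreover have "?I \<subseteq> A" by blast
      ultimately show ?thesis using indep fin that(2) unfolding lin_indep_def by blast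
    qed
    show "\<exists>c. v = (\<Sum>k\<in>?I. c k *\<^sub>R F k)" if v: "v \<in> degree_part d" "Dmat Y v = 0" for v
    proof -
      obtain c where c: "\<And>\<mu>. v \<mu> = (\<Sum>t\<in>{t\<in>A. c t * F t \<mu> \<noteq> 0}. c t * F t \<mu>)"
        using span[OF v(2)] unfolding count_lin_comb_def by blast
      have "v \<mu> = (\<Sum>k\<in>?I. c k * F k \<mu>)" for \<mu>
      proof (cases "mdeg \<mu> = d")
        case True
        have "{t\<in>A. c t * F t \<mu> \<noteq> 0} \<subseteq> ?I"
        proof clarify
          fix t assume t: "t \<in> A" "c t * F t \<mu> \<noteq> 0"
          then have "mdeg \<mu> = hdeg (F t)"
            using hdeg[OF hom[OF t(1)]] by (auto simp: degree_part_def)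
          with True show "hdeg (F t) = d" by simp
        qed
        then show ?thesis unfolding c[of \<mu>] using fin by (intro sum.mono_neutral_left) auto
      next
        case False
        then have "F k \<mu> = 0" if "k \<in> ?I" for k using FV[OF that] by (simp add: degree_part_def)
        then show ?thesis using v(1) False by (simp add: degree_part_def)
      qed
      then show ?thesis by (intro exI[of _ c]) (auto simp: fun_eq_iff sum_apply)
    qed
  qed
qed

section \<open>Transvectants\<close>

lemma case_sum_comp: "case_sum (\<mu> \<circ> Inl) (\<mu> \<circ> Inr) = \<mu>"
  by (auto simp: fun_eq_iff split: sum.split)

lemma transvectant_apply:
  "transvectant Y1 Y2 u f v g s \<mu>
     = (\<Sum>j\<le>s. tcoef u v s j * ((Y1 ^^ j) f (\<mu> \<circ> Inl) * (Y2 ^^ (s - j)) g (\<mu> \<circ> Inr)))"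
  by (simp add: transvectant_def tcoef_def tens_def)

lemma Dmat_mmono_eigen:
  assumes "\<forall>i<p. Dmat A (\<alpha> i) = lam i *\<^sub>R \<alpha> i"
  shows "Dmat A (mmono p \<alpha> k) = (\<Sum>i<p. lam i * real (k i)) *\<^sub>R mmono p \<alpha> k"
  using assms unfolding Dmat_def by (rule Dop_mmono_eigen)

lemma funpow_degree_part: "f \<in> degree_part d \<Longrightarrow> (Dmat A ^^ j) f \<in> degree_part d"
  by (induction j) (auto intro: Dmat_degree_part)

definition bideg :: "('n::finite + 'm::finite \<Rightarrow> nat) \<Rightarrow> nat \<times> nat" where
  "bideg \<mu> = (mdeg (\<mu> \<circ> Inl), mdeg (\<mu> \<circ> Inr))"

lemma finite_bideg: "finite {\<mu>. bideg \<mu> = ab}"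
proof (rule finite_subset)
  show "{\<mu>. bideg \<mu> = ab} \<subseteq> (\<lambda>(\<nu>, \<rho>). case_sum \<nu> \<rho>) ` ({\<nu>. mdeg \<nu> = fst ab} \<times> {\<rho>. mdeg \<rho> = snd ab})"
  proof
    fix \<mu> assume "\<mu> \<in> {\<mu>. bideg \<mu> = ab}"
    then have "(\<mu> \<circ> Inl, \<mu> \<circ> Inr) \<in> {\<nu>. mdeg \<nu> = fst ab} \<times> {\<rho>. mdeg \<rho> = snd ab}"
      by (auto simp: bideg_def)
    from imageI[OF this, of "\<lambda>(\<nu>, \<rho>). case_sum \<nu> \<rho>"]
    show "\<mu> \<in> (\<lambda>(\<nu>, \<rho>). case_sum \<nu> \<rho>) ` ({\<nu>. mdeg \<nu> = fst ab} \<times> {\<rho>. mdeg \<rho> = snd ab})"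
      by (simp only: prod.case case_sum_comp)
  qed
qed (intro finite_imageI finite_cartesian_product finite_mdeg)

text \<open>\<open>\<alpha> k\<close> and \<open>\<beta> l\<close> stand for whole monomials here,
  indexed by exponent vectors, with weights \<open>u\<close> and \<open>v\<close>.\<close>

locale transvectant_setup =
  fixes Xa Ya Za :: "real^'n::finite^'n" and Xg Yg Zg :: "real^'m::finite^'m"
    and K :: "'i set" and \<alpha> :: "'i \<Rightarrow> 'n mfps" and u :: "'i \<Rightarrow> nat"
    and L :: "'j set" and \<beta> :: "'j \<Rightarrow> 'm mfps" and v :: "'j \<Rightarrow> nat"
  assumes triad_a: "sl2_triad Xa Ya Za" and triad_g: "sl2_triad Xg Yg Zg"
    and hom_a: "\<And>k. k \<in> K \<Longrightarrow> homogeneous (\<alpha> k)" and hom_g: "\<And>l. l \<in> L \<Longrightarrow> homogeneous (\<beta> l)"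
    and ker_a: "\<And>k. k \<in> K \<Longrightarrow> Dmat Ya (\<alpha> k) = 0" and ker_g: "\<And>l. l \<in> L \<Longrightarrow> Dmat Yg (\<beta> l) = 0"
    and wt_a: "\<And>k. k \<in> K \<Longrightarrow> Dmat Za (\<alpha> k) = real (u k) *\<^sub>R \<alpha> k"
    and wt_g: "\<And>l. l \<in> L \<Longrightarrow> Dmat Zg (\<beta> l) = real (v l) *\<^sub>R \<beta> l"
    and indep_a: "lin_indep K \<alpha>" and indep_g: "lin_indep L \<beta>"
    and span_a: "\<And>f. Dmat Ya f = 0 \<Longrightarrow> count_lin_comb K \<alpha> f"
    and span_g: "\<And>f. Dmat Yg f = 0 \<Longrightarrow> count_lin_comb L \<beta> f"
begin

definition J :: "('n + 'm) mfps set" where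
  "J = {f. (\<lambda>\<mu>. Dmat_x Ya f \<mu> + Dmat_y Yg f \<mu>) = (\<lambda>_. 0)}"

definition T :: "('i \<times> 'j \<times> nat) set" where
  "T = {(k, l, s). k \<in> K \<and> l \<in> L \<and> s \<le> u k \<and> s \<le> v l}"

definition F :: "'i \<times> 'j \<times> nat \<Rightarrow> ('n + 'm) mfps" where
  "F = (\<lambda>(k, l, s). transvectant (Dmat Xa) (Dmat Xg) (u k) (\<alpha> k) (v l) (\<beta> l) s)"

text \<open>The bidegree of a transvectant; \<open>s\<close> does not enter because the lowering
  operators preserve degree.\<close>

definition tdeg :: "'i \<times> 'j \<times> nat \<Rightarrow> nat \<times> nat" where
  "tdeg = (\<lambda>(k, l, s). (hdeg (\<alpha> k), hdeg (\<beta> l)))"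

definition T_at :: "nat \<times> nat \<Rightarrow> ('i \<times> 'j \<times> nat) set" where
  "T_at d = {t\<in>T. tdeg t = d}"

text \<open>One tensor product for every bidegree \<open>(a, b)\<close>. \<open>pair.inv\<close> and
  \<open>pair.tv\<close> are common to all of them, while \<open>pair.T\<close> depends on the
  bidegree.\<close>

sublocale pair: sl2_pair
  "Dmat Ya" "Dmat Xa" "Dmat Za" "degree_part a" "monom_basis a" "{k\<in>K. hdeg (\<alpha> k) = a}" \<alpha> u
  "Dmat Yg" "Dmat Xg" "Dmat Zg" "degree_part b" "monom_basis b" "{l\<in>L. hdeg (\<beta> l) = b}" \<beta> v
  "{\<mu>. mdeg \<mu> = a}" "{\<mu>. mdeg \<mu> = b}" for a b
proof -
  interpret A: sl2_hw "Dmat Ya" "Dmat Xa" "Dmat Za" "degree_part a" "monom_basis a" "{k\<in>K. hdeg (\<alpha> k) = a}" \<alpha> u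
    by (rule sl2_hw_degree_part[OF triad_a hom_a ker_a wt_a indep_a span_a])
  interpret B: sl2_hw "Dmat Yg" "Dmat Xg" "Dmat Zg" "degree_part b" "monom_basis b" "{l\<in>L. hdeg (\<beta> l) = b}" \<beta> v
    by (rule sl2_hw_degree_part[OF triad_g hom_g ker_g wt_g indep_g span_g])
  show "sl2_pair (Dmat Ya) (Dmat Xa) (Dmat Za) (degree_part a) (monom_basis a) {k\<in>K. hdeg (\<alpha> k) = a} \<alpha> u
    (Dmat Yg) (Dmat Xg) (Dmat Zg) (degree_part b) (monom_basis b) {l\<in>L. hdeg (\<beta> l) = b} \<beta> v
    {\<mu>. mdeg \<mu> = a} {\<mu>. mdeg \<mu> = b}"
    by unfold_locales (simp_all add: degree_part_def)
qed

lemma pair_T: "pair.T a b = T_at (a, b)"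
proof (rule set_eqI)
  fix t show "t \<in> pair.T a b \<longleftrightarrow> t \<in> T_at (a, b)"
    by (cases t) (simp add: pair.T_def T_at_def T_def tdeg_def, blast)
qed

lemma finite_T_at: "finite (T_at d)"
  using pair.finite_T[of "fst d" "snd d"] unfolding pair_T by simp

lemma F_apply: "F (k, l, s) \<mu> = pair.tv k l s (\<mu> \<circ> Inl) (\<mu> \<circ> Inr)"
  by (simp add: F_def transvectant_apply pair.tv_def)

lemma F_case_sum: "F (k, l, s) (case_sum \<nu> \<rho>) = pair.tv k l s \<nu> \<rho>"
  by (simp add: F_apply case_sum_o_inj)

lemma J_iff: "f \<in> J \<longleftrightarrow> pair.inv (\<lambda>\<nu> \<rho>. f (case_sum \<nu> \<rho>))"
proof
  assume "f \<in> J"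
  then have "Dmat_x Ya f \<mu> + Dmat_y Yg f \<mu> = 0" for \<mu>
    unfolding J_def by (auto dest: fun_cong)
  then show "pair.inv (\<lambda>\<nu> \<rho>. f (case_sum \<nu> \<rho>))"
    unfolding pair.inv_def by (simp add: Dmat_x_case_sum[symmetric] Dmat_y_case_sum[symmetric])
next
  assume *: "pair.inv (\<lambda>\<nu> \<rho>. f (case_sum \<nu> \<rho>))"
  have "Dmat_x Ya f (case_sum \<nu> \<rho>) + Dmat_y Yg f (case_sum \<nu> \<rho>) = 0" for \<nu> \<rho>
    using * unfolding pair.inv_def Dmat_x_case_sum Dmat_y_case_sum by blast
  from this[of "\<mu> \<circ> Inl" "\<mu> \<circ> Inr" for \<mu>] show "f \<in> J"
    unfolding case_sum_comp J_def by auto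
qed

lemma F_in_J:
  assumes "t \<in> T" shows "F t \<in> J"
proof -
  obtain k l s where "t = (k, l, s)" "k \<in> K" "l \<in> L" "s \<le> u k" "s \<le> v l"
    using assms by (auto simp: T_def)
  then show ?thesis
    unfolding J_iff by (simp add: F_case_sum pair.tv_inv[of k "hdeg (\<alpha> k)" l "hdeg (\<beta> l)"])
qed

lemma F_bideg:
  assumes "t \<in> T" "F t \<mu> \<noteq> 0" shows "bideg \<mu> = tdeg t"
proof -
  obtain k l s where t: "t = (k, l, s)" "k \<in> K" "l \<in> L"
    using assms(1) by (auto simp: T_def)
  have "(\<Sum>j\<le>s. tcoef (u k) (v l) s j * ((Dmat Xa ^^ j) (\<alpha> k) (\<mu> \<circ> Inl)
      * (Dmat Xg ^^ (s - j)) (\<beta> l) (\<mu> \<circ> Inr))) \<noteq> 0"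
    using assms(2) unfolding t F_apply pair.tv_def .
  then obtain j where "tcoef (u k) (v l) s j * ((Dmat Xa ^^ j) (\<alpha> k) (\<mu> \<circ> Inl)
      * (Dmat Xg ^^ (s - j)) (\<beta> l) (\<mu> \<circ> Inr)) \<noteq> 0"
    by (rule sum.not_neutral_contains_not_neutral)
  then have nz: "(Dmat Xa ^^ j) (\<alpha> k) (\<mu> \<circ> Inl) \<noteq> 0" "(Dmat Xg ^^ (s - j)) (\<beta> l) (\<mu> \<circ> Inr) \<noteq> 0"
    by simp_all
  have mem: "(Dmat Xa ^^ j) (\<alpha> k) \<in> degree_part (hdeg (\<alpha> k))" "(Dmat Xg ^^ (s - j)) (\<beta> l) \<in> degree_part (hdeg (\<beta> l))"
    by (intro funpow_degree_part hdeg hom_a hom_g t)+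
  have "mdeg (\<mu> \<circ> Inl) = hdeg (\<alpha> k)"
    using mem(1)[unfolded degree_part_def, THEN CollectD, THEN spec[of _ "\<mu> \<circ> Inl"]] nz(1) by simp
  moreover have "mdeg (\<mu> \<circ> Inr) = hdeg (\<beta> l)"
    using mem(2)[unfolded degree_part_def, THEN CollectD, THEN spec[of _ "\<mu> \<circ> Inr"]] nz(2) by simp
  ultimately show ?thesis by (simp add: bideg_def tdeg_def t)
qed

lemma independent_at:
  assumes 0: "\<And>\<mu>. (\<Sum>t\<in>T_at d. c t * F t \<mu>) = 0" and t: "t \<in> T_at d"
  shows "c t = 0"
proof (rule pair.tv_independent_T[of c "fst d" "snd d"])
  show "(\<Sum>(k, l, s)\<in>pair.T (fst d) (snd d). c (k, l, s) * pair.tv k l s \<nu> \<rho>) = 0" for \<nu> \<rho>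
    using 0[of "case_sum \<nu> \<rho>"] by (simp add: pair_T F_case_sum[symmetric] split_def)
qed (use t in \<open>simp add: pair_T\<close>)

lemma span_at:
  assumes f: "f \<in> J" and supp: "\<And>\<mu>. bideg \<mu> \<noteq> d \<Longrightarrow> f \<mu> = 0"
  shows "\<exists>c. \<forall>\<mu>. f \<mu> = (\<Sum>t\<in>T_at d. c t * F t \<mu>)"
proof -
  have "\<exists>c. \<forall>\<nu> \<rho>. f (case_sum \<nu> \<rho>) = (\<Sum>(k, l, s)\<in>pair.T (fst d) (snd d). c (k, l, s) * pair.tv k l s \<nu> \<rho>)"
  proof (rule pair.tv_span_T)
    show "f (case_sum \<nu> \<rho>) = 0" if "\<nu> \<notin> {\<mu>. mdeg \<mu> = fst d} \<or> \<rho> \<notin> {\<mu>. mdeg \<mu> = snd d}" for \<nu> \<rho>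
      by (rule supp) (use that in \<open>auto simp: bideg_def case_sum_o_inj\<close>)
  qed (use f in \<open>simp add: J_iff\<close>)
  then obtain c where "\<And>\<nu> \<rho>. f (case_sum \<nu> \<rho>) = (\<Sum>t\<in>T_at d. c t * F t (case_sum \<nu> \<rho>))"
    by (auto simp: pair_T F_case_sum[symmetric] split_def)
  from this[of "\<mu> \<circ> Inl" "\<mu> \<circ> Inr" for \<mu>] show ?thesis
    unfolding case_sum_comp by blast
qed

text \<open>At bidegree \<open>d\<close> the truncation leaves the equation unchanged, and at any
  other bidegree both terms vanish, since the operators only read coefficients of the same
  degree.\<close>

lemma bihomogeneous_part_in_J:
  assumes f: "f \<in> J" shows "(\<lambda>\<mu>. if bideg \<mu> = d then f \<mu> else 0) \<in> J"
  unfolding J_iff pair.inv_def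
proof (intro allI)
  fix \<nu> :: "'n \<Rightarrow> nat" and \<rho> :: "'m \<Rightarrow> nat"
  let ?f = "\<lambda>\<mu>. if bideg \<mu> = d then f \<mu> else 0"
  have b: "bideg (case_sum \<nu> \<rho>) = (mdeg \<nu>, mdeg \<rho>)" for \<nu> :: "'n \<Rightarrow> nat" and \<rho> :: "'m \<Rightarrow> nat"
    by (simp add: bideg_def case_sum_o_inj)
  show "Dmat Ya (\<lambda>\<nu>. ?f (case_sum \<nu> \<rho>)) \<nu> + Dmat Yg (\<lambda>\<rho>. ?f (case_sum \<nu> \<rho>)) \<rho> = 0"
  proof (cases "(mdeg \<nu>, mdeg \<rho>) = d")
    case True
    have "Dmat Ya (\<lambda>\<nu>. ?f (case_sum \<nu> \<rho>)) \<nu> = Dmat Ya (\<lambda>\<nu>. f (case_sum \<nu> \<rho>)) \<nu>"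
      unfolding Dmat_def by (rule Dop_cong_degree) (use True in \<open>simp add: b\<close>)
    moreover have "Dmat Yg (\<lambda>\<rho>. ?f (case_sum \<nu> \<rho>)) \<rho> = Dmat Yg (\<lambda>\<rho>. f (case_sum \<nu> \<rho>)) \<rho>"
      unfolding Dmat_def by (rule Dop_cong_degree) (use True in \<open>simp add: b\<close>)
    ultimately show ?thesis using f unfolding J_iff pair.inv_def by simp
  next
    case False
    have "Dmat Ya (\<lambda>\<nu>. ?f (case_sum \<nu> \<rho>)) \<nu> = 0"
      unfolding Dmat_def by (rule Dop_zero_apply) (use False in \<open>simp add: b\<close>)
    moreover have "Dmat Yg (\<lambda>\<rho>. ?f (case_sum \<nu> \<rho>)) \<rho> = 0"
      unfolding Dmat_def by (rule Dop_zero_apply) (use False in \<open>simp add: b\<close>)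
    ultimately show ?thesis by simp
  qed
qed

lemma polynomial_F: "t \<in> T \<Longrightarrow> is_polynomial (F t)"
  unfolding is_polynomial_def
  by (rule finite_subset[OF _ finite_bideg[of "tdeg t"]]) (auto dest: F_bideg)

text \<open>Fix \<open>t\<close> and read the relation at the bidegree of \<open>t\<close>: only
  transvectants of that bidegree survive, and these are independent.\<close>

lemma lin_indep_F: "lin_indep T F"
  unfolding lin_indep_def
proof (intro allI impI ballI)
  fix S c t
  assume S: "finite S" "S \<subseteq> T" and 0: "\<forall>\<mu>. (\<Sum>t\<in>S. c t * F t \<mu>) = 0" and t: "t \<in> S"
  let ?c = "\<lambda>t. if t \<in> S then c t else 0"
  have "(\<Sum>t'\<in>T_at (tdeg t). ?c t' * F t' \<mu>) = 0" for \<mu>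
  proof (cases "bideg \<mu> = tdeg t")
    case True
    have "(\<Sum>t'\<in>T_at (tdeg t). ?c t' * F t' \<mu>) = (\<Sum>t'\<in>S \<inter> T_at (tdeg t). c t' * F t' \<mu>)"
      using finite_T_at by (intro sum.mono_neutral_cong_right) auto
    also have "\<dots> = (\<Sum>t'\<in>S. c t' * F t' \<mu>)"
    proof (rule sum.mono_neutral_left)
      show "\<forall>t'\<in>S - S \<inter> T_at (tdeg t). c t' * F t' \<mu> = 0"
        using S(2) F_bideg[of _ \<mu>] True by (fastforce simp: T_at_def)
    qed (use S in auto)
    finally show ?thesis using 0 by simp
  next
    case False
    then show ?thesis using F_bideg[of _ \<mu>] by (intro sum.neutral) (fastforce simp: T_at_def)
  qed
  then have "?c t = 0" by (rule independent_at) (use S t in \<open>auto simp: T_at_def\<close>)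
  then show "c t = 0" using t by simp
qed

lemma bihomogeneous_expansion:
  assumes "f \<in> J"
  obtains c where "\<And>\<mu>. f \<mu> = (\<Sum>t\<in>T_at (bideg \<mu>). c t * F t \<mu>)"
proof -
  have "\<forall>d. \<exists>c. \<forall>\<mu>. (if bideg \<mu> = d then f \<mu> else 0) = (\<Sum>t\<in>T_at d. c t * F t \<mu>)"
    by (intro allI span_at bihomogeneous_part_in_J assms) simp
  from choice[OF this] obtain c
    where c: "\<And>d \<mu>. (if bideg \<mu> = d then f \<mu> else 0) = (\<Sum>t\<in>T_at d. c d t * F t \<mu>)"
    by blast
  \<comment> \<open>Each index has exactly one bidegree, so the separate expansions glue to a single
    coefficient function.\<close>
  have "f \<mu> = (\<Sum>t\<in>T_at (bideg \<mu>). c (tdeg t) t * F t \<mu>)" for \<mu>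
    using c[of \<mu> "bideg \<mu>"] by (simp add: T_at_def)
  then show thesis by (rule that)
qed

lemma count_lin_comb_F:
  assumes "f \<in> J" shows "count_lin_comb T F f"
proof -
  obtain c where c: "\<And>\<mu>. f \<mu> = (\<Sum>t\<in>T_at (bideg \<mu>). c t * F t \<mu>)"
    using bihomogeneous_expansion[OF assms] by blast
  have sub: "{t\<in>T. c t * F t \<mu> \<noteq> 0} \<subseteq> T_at (bideg \<mu>)" for \<mu>
    using F_bideg[of _ \<mu>] by (auto simp: T_at_def)
  have "f \<mu> = (\<Sum>t\<in>{t\<in>T. c t * F t \<mu> \<noteq> 0}. c t * F t \<mu>)" for \<mu>
    unfolding c by (rule sum.mono_neutral_right[OF finite_T_at sub]) (auto simp: T_at_def)
  then show ?thesis
    unfolding count_lin_comb_def using finite_subset[OF sub finite_T_at] by blast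
qed

lemma fin_lin_comb_F:
  assumes "f \<in> J" "is_polynomial f" shows "fin_lin_comb T F f"
proof -
  obtain c where c: "\<And>\<mu>. f \<mu> = (\<Sum>t\<in>T_at (bideg \<mu>). c t * F t \<mu>)"
    using bihomogeneous_expansion[OF assms(1)] by blast
  \<comment> \<open>A polynomial meets finitely many bidegrees, each with finitely many
    indices.\<close>
  let ?D = "bideg ` {\<mu>. f \<mu> \<noteq> 0}"
  let ?S = "\<Union>d\<in>?D. T_at d"
  have fin: "finite ?S" using assms(2) finite_T_at unfolding is_polynomial_def by blast
  have "f \<mu> = (\<Sum>t\<in>?S. c t * F t \<mu>)" for \<mu>
  proof (cases "bideg \<mu> \<in> ?D")
    case True
    show ?thesis unfolding c[of \<mu>]
    proof (rule sum.mono_neutral_left[OF fin])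
      show "T_at (bideg \<mu>) \<subseteq> ?S" using True by blast
      show "\<forall>t\<in>?S - T_at (bideg \<mu>). c t * F t \<mu> = 0"
        using F_bideg[of _ \<mu>] by (fastforce simp: T_at_def)
    qed
  next
    case False
    then have "F t \<mu> = 0" if "t \<in> ?S" for t
      using that F_bideg[of t \<mu>] by (auto simp: T_at_def)
    moreover have "f \<mu> = 0" using False by blast
    ultimately show ?thesis by simp
  qed
  moreover have "?S \<subseteq> T" by (auto simp: T_at_def)
  ultimately show ?thesis using fin unfolding fin_lin_comb_def by blast
qed

end

theorem theorem8p4:
  fixes Xa Ya Za :: "real^'n::finite^'n"
    and Xg Yg Zg :: "real^'m::finite^'m"
    and p q :: nat
    and \<alpha> :: "nat \<Rightarrow> 'n mfps" and w\<alpha> :: "nat \<Rightarrow> nat"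
    and \<beta> :: "nat \<Rightarrow> 'm mfps" and w\<beta> :: "nat \<Rightarrow> nat"
    and Aa Ag :: "(nat \<Rightarrow> nat) set"
  assumes triad_a: "sl2_triad Xa Ya Za"
    and triad_g: "sl2_triad Xg Yg Zg"
    \<comment> \<open>alpha is a Hilbert basis of acute J = ker (D_{acute Y})\<close>
    and alpha_hom: "\<forall>i<p. homogeneous (\<alpha> i)"
    and alpha_inv: "\<forall>i<p. Dmat Ya (\<alpha> i) = (\<lambda>_. 0)"
    and alpha_wt: "\<forall>i<p. Dmat Za (\<alpha> i) = (\<lambda>\<mu>. real (w\<alpha> i) * \<alpha> i \<mu>)"
    and alpha_span: "\<forall>f. Dmat Ya f = (\<lambda>_. 0) \<longrightarrow> count_lin_comb (natvecs p) (mmono p \<alpha>) f"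
    \<comment> \<open>beta is a Hilbert basis of grave J = ker (D_{grave Y})\<close>
    and beta_hom: "\<forall>i<q. homogeneous (\<beta> i)"
    and beta_inv: "\<forall>i<q. Dmat Yg (\<beta> i) = (\<lambda>_. 0)"
    and beta_wt: "\<forall>i<q. Dmat Zg (\<beta> i) = (\<lambda>\<mu>. real (w\<beta> i) * \<beta> i \<mu>)"
    and beta_span: "\<forall>g. Dmat Yg g = (\<lambda>_. 0) \<longrightarrow> count_lin_comb (natvecs q) (mmono q \<beta>) g"
    \<comment> \<open>standard preferred sets\<close>
    and Aa_sub: "Aa \<subseteq> natvecs p"
    and Aa_inj: "inj_on (mmono p \<alpha>) Aa"
    and Aa_indep: "lin_indep Aa (mmono p \<alpha>)"
    and Aa_span: "\<forall>f. Dmat Ya f = (\<lambda>_. 0) \<longrightarrow> count_lin_comb Aa (mmono p \<alpha>) f"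
    and Aa_down: "down_closed Aa"
    and Ag_sub: "Ag \<subseteq> natvecs q"
    and Ag_inj: "inj_on (mmono q \<beta>) Ag"
    and Ag_indep: "lin_indep Ag (mmono q \<beta>)"
    and Ag_span: "\<forall>g. Dmat Yg g = (\<lambda>_. 0) \<longrightarrow> count_lin_comb Ag (mmono q \<beta>) g"
    and Ag_down: "down_closed Ag"
  shows
    "let J = {f :: ('n + 'm) mfps. (\<lambda>\<mu>. Dmat_x Ya f \<mu> + Dmat_y Yg f \<mu>) = (\<lambda>_. 0)};
         T = {(k, l, s). k \<in> Aa \<and> l \<in> Ag \<and> s \<le> wdot p w\<alpha> k \<and> s \<le> wdot q w\<beta> l};
         F = (\<lambda>(k, l, s). transvectant (Dmat Xa) (Dmat Xg)
                (wdot p w\<alpha> k) (mmono p \<alpha> k) (wdot q w\<beta> l) (mmono q \<beta> l) s)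
     in (\<forall>t\<in>T. F t \<in> J \<and> is_polynomial (F t))
        \<and> lin_indep T F
        \<and> (\<forall>f\<in>J. is_polynomial f \<longrightarrow> fin_lin_comb T F f)
        \<and> (\<forall>f\<in>J. count_lin_comb T F f)"
proof -
  interpret transvectant_setup Xa Ya Za Xg Yg Zg Aa "mmono p \<alpha>" "wdot p w\<alpha>" Ag "mmono q \<beta>" "wdot q w\<beta>"
  proof
    show "homogeneous (mmono p \<alpha> k)" for k using alpha_hom by (rule homogeneous_mmono)
    show "homogeneous (mmono q \<beta> l)" for l using beta_hom by (rule homogeneous_mmono)
    \<comment> \<open>Every generator has eigenvalue 0, hence so does every monomial.\<close>
    show "Dmat Ya (mmono p \<alpha> k) = 0" for k
      using Dmat_mmono_eigen[of p Ya \<alpha> "\<lambda>_. 0" k] alpha_inv by (simp add: zero_fun_def)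
    show "Dmat Yg (mmono q \<beta> l) = 0" for l
      using Dmat_mmono_eigen[of q Yg \<beta> "\<lambda>_. 0" l] beta_inv by (simp add: zero_fun_def)
    show "Dmat Za (mmono p \<alpha> k) = real (wdot p w\<alpha> k) *\<^sub>R mmono p \<alpha> k" for k
      using Dmat_mmono_eigen[of p Za \<alpha> "\<lambda>i. real (w\<alpha> i)" k] alpha_wt by (simp add: wdot_def scaleR_fun_def)
    show "Dmat Zg (mmono q \<beta> l) = real (wdot q w\<beta> l) *\<^sub>R mmono q \<beta> l" for l
      using Dmat_mmono_eigen[of q Zg \<beta> "\<lambda>i. real (w\<beta> i)" l] beta_wt by (simp add: wdot_def scaleR_fun_def)
    show "count_lin_comb Aa (mmono p \<alpha>) f" if "Dmat Ya f = 0" for f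
      using Aa_span that by (simp add: zero_fun_def)
    show "count_lin_comb Ag (mmono q \<beta>) f" if "Dmat Yg f = 0" for f
      using Ag_span that by (simp add: zero_fun_def)
  qed (fact triad_a triad_g Aa_indep Ag_indep)+
  show ?thesis
    unfolding Let_def J_def[symmetric] T_def[symmetric] F_def[symmetric]
    by (intro conjI ballI impI F_in_J polynomial_F lin_indep_F fin_lin_comb_F count_lin_comb_F)
qed

end
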